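(* Neither $L_{10}$ nor $L_{11}$ is a union of congruence classes modulo $N$ for any positive integer $N$.
   Context: Let $\omega=\zeta_7$ be a primitive 7th root of unity, $K=\mathbb Q(\omega)$, $R=\mathbb Z[\omega]$, $\pi=1-\omega$. Put $A=R/7R\cong\mathbb F_7[\pi]/(\pi^6)$ and, in $A$, $\Lambda=\log\omega=-\sum_{j=1}^5\pi^j/j$; then $A=\mathbb F_7[\Lambda]/(\Lambda^6)$. For $z\in A^\times$ with constant residue $a=z\bmod\pi\in\mathbb F_7^\times$ write $\log(z/a)=\sum_{j=1}^5c_j(z)\Lambda^j$, where $\log(1+X)=\sum_{j=1}^5(-1)^{j+1}X^j/j$ for $X\in\pi A$, and define $\mathrm d(z)=4c_3(z)$, $\mathrm e(z)=c_5(z)$, both in $\mathbb F_7$. The field $K$ has class number one, so every ideal $\mathfrak a$ of $R$ coprime to $7$ has a generator; $\mathrm d(\mathfrak a)$ and $\mathrm e(\mathfrak a)$ denote the values at any generator (they are independent of the generator). For a rational prime $\ell\ne7$, $f_\ell=\operatorname{ord}_7(\ell)$ is the multiplicative order of $\ell$ modulo $7$. Choose a prime ideal $\mathfrak q\mid\ell$ of $R$. $\delta(\ell)\in\{0,1,2,3\}$ is the unique representative of the pair $\{\pm\mathrm d(\mathfrak q)\}\subset\mathbb F_7$, and $\ell$ is called invisible if $(\mathrm d(\mathfrak q),\mathrm e(\mathfrak q))=(0,0)$; both are independent of the choice of $\mathfrak q$. A prime divisor $\ell$ of $m=\pm\prod_{\ell\neq7}\ell^{a_\ell}$ is called usable if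 $a_\ell\ge f_\ell$. $L_{10}$ is the set of nonzero integers $m=\pm\prod_{\ell\ne7}\ell^{a_\ell}$ coprime to $7$ for which there exist integers $j_\ell$ with $|j_\ell|\le\lfloor a_\ell/f_\ell\rfloor$ and $\sum_\ell j_\ell\delta(\ell)\equiv\pm1\pmod7$. $L_{11}$ is the set of nonzero integers $m$ coprime to $7$ having a usable prime divisor that is not invisible. (These are the sets of cofactors $m$ coprime to $7$ for which $7^{10}m$, respectively $7^{11}m$, is an integer group determinant of $C_7\times C_7$.) *)

theory Defs
  imports Complex_Main "HOL-Computational_Algebra.Polynomial" "HOL-Number_Theory.Number_Theory" "HOL-Algebra.QuotRing"
begin

text \<open>
  Throughout, \<open>\<omega>\<close> stands for a primitive 7th root of unity in the complex numbers, and elements of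
  the field with seven elements are represented by the integers \<open>0, \<dots>, 6\<close>.
\<close>

definition Zomega :: "complex \<Rightarrow> complex ring" where
  "Zomega \<omega> = \<lparr>carrier = {poly (map_poly of_int p) \<omega> | p :: int poly. True},
          mult = (*), one = 1, zero = 0, add = (+)\<rparr>"

definition A7 :: "complex \<Rightarrow> complex set ring" where
  "A7 \<omega> = Zomega \<omega> Quot (PIdl\<^bsub>Zomega \<omega>\<^esub> 7)"

definition to_A :: "complex \<Rightarrow> complex \<Rightarrow> complex set" where
  "to_A \<omega> z = PIdl\<^bsub>Zomega \<omega>\<^esub> 7 +>\<^bsub>Zomega \<omega>\<^esub> z"

definition pi_A :: "complex \<Rightarrow> complex set" where
  "pi_A \<omega> = to_A \<omega> (1 - \<omega>)"

text \<open>The truncated logarithm of \<open>1 + X\<close> for \<open>X\<close> in \<open>\<pi> A7\<close>; 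
  the denominators \<open>1, \<dots>, 5\<close> are units of \<open>A7\<close>.\<close>

definition log_A :: "complex \<Rightarrow> complex set \<Rightarrow> complex set" where
  "log_A \<omega> y =
     (\<Oplus>\<^bsub>A7 \<omega>\<^esub>j\<in>{1..5::nat}. to_A \<omega> ((- 1) ^ (j + 1)) \<otimes>\<^bsub>A7 \<omega>\<^esub>
        ((y \<ominus>\<^bsub>A7 \<omega>\<^esub> \<one>\<^bsub>A7 \<omega>\<^esub>) [^]\<^bsub>A7 \<omega>\<^esub> j) \<otimes>\<^bsub>A7 \<omega>\<^esub> inv\<^bsub>A7 \<omega>\<^esub> (to_A \<omega> (of_nat j)))"

text \<open>Since \<open>\<omega> = 1 - \<pi>\<close>, this is \<open>- (\<pi> + \<pi>\<^sup>2 / 2 + \<dots> + \<pi>\<^sup>5 / 5)\<close>.\<close>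

definition Lambda :: "complex \<Rightarrow> complex set" where
  "Lambda \<omega> = log_A \<omega> (to_A \<omega> \<omega>)"

definition residue_A :: "complex \<Rightarrow> complex set \<Rightarrow> int" where
  "residue_A \<omega> z =
     (THE a. a \<in> {0..<7} \<and> z \<ominus>\<^bsub>A7 \<omega>\<^esub> to_A \<omega> (of_int a) \<in> PIdl\<^bsub>A7 \<omega>\<^esub> (pi_A \<omega>))"

text \<open>The coefficients \<open>c\<^sub>j(z)\<close>, meaningful for units \<open>z\<close> of \<open>A7\<close>.\<close>

definition log_coeffs :: "complex \<Rightarrow> complex set \<Rightarrow> nat \<Rightarrow> int" where
  "log_coeffs \<omega> z =
     (THE c. (\<forall>j\<in>{1..5}. c j \<in> {0..<7}) \<and> (\<forall>j. j \<notin> {1..5} \<longrightarrow> c j = 0) \<and>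
        log_A \<omega> (z \<otimes>\<^bsub>A7 \<omega>\<^esub> inv\<^bsub>A7 \<omega>\<^esub> (to_A \<omega> (of_int (residue_A \<omega> z)))) =
        (\<Oplus>\<^bsub>A7 \<omega>\<^esub>j\<in>{1..5::nat}. to_A \<omega> (of_int (c j)) \<otimes>\<^bsub>A7 \<omega>\<^esub> (Lambda \<omega> [^]\<^bsub>A7 \<omega>\<^esub> j)))"

definition d_A :: "complex \<Rightarrow> complex set \<Rightarrow> int" where
  "d_A \<omega> z = (4 * log_coeffs \<omega> z 3) mod 7"

definition e_A :: "complex \<Rightarrow> complex set \<Rightarrow> int" where
  "e_A \<omega> z = log_coeffs \<omega> z 5"

text \<open>
  Every ideal of \<open>Zomega\<close> is principal, and for an ideal coprime to 7 the values of \<open>d_A\<close> and \<open>e_A\<close> at a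
  generator do not depend on the generator.
\<close>

definition generator :: "complex \<Rightarrow> complex set \<Rightarrow> complex" where
  "generator \<omega> I = (SOME g. g \<in> carrier (Zomega \<omega>) \<and> I = PIdl\<^bsub>Zomega \<omega>\<^esub> g)"

definition d_ideal :: "complex \<Rightarrow> complex set \<Rightarrow> int" where
  "d_ideal \<omega> I = d_A \<omega> (to_A \<omega> (generator \<omega> I))"

definition e_ideal :: "complex \<Rightarrow> complex set \<Rightarrow> int" where
  "e_ideal \<omega> I = e_A \<omega> (to_A \<omega> (generator \<omega> I))"

text \<open>
  A prime ideal divides the rational prime \<open>l\<close> iff it contains \<open>l\<close>. The notions \<open>delta\<close> and
  \<open>invisible\<close> below do not depend on which such ideal is chosen.
\<close>

definition prime_above :: "complex \<Rightarrow> nat \<Rightarrow> complex set" where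
  "prime_above \<omega> l = (SOME q. primeideal q (Zomega \<omega>) \<and> of_nat l \<in> q)"

definition delta :: "complex \<Rightarrow> nat \<Rightarrow> int" where
  "delta \<omega> l = (THE k. k \<in> {0..3} \<and>
     ([k = d_ideal \<omega> (prime_above \<omega> l)] (mod 7) \<or> [k = - d_ideal \<omega> (prime_above \<omega> l)] (mod 7)))"

definition invisible :: "complex \<Rightarrow> nat \<Rightarrow> bool" where
  "invisible \<omega> l \<longleftrightarrow>
     (d_ideal \<omega> (prime_above \<omega> l), e_ideal \<omega> (prime_above \<omega> l)) = (0, 0)"

definition usable :: "int \<Rightarrow> nat \<Rightarrow> bool" where
  "usable m l \<longleftrightarrow> l \<in> prime_factors (nat \<bar>m\<bar>) \<and> ord 7 l \<le> multiplicity l (nat \<bar>m\<bar>)"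

definition L10 :: "complex \<Rightarrow> int set" where
  "L10 \<omega> = {m. m \<noteq> 0 \<and> coprime m 7 \<and>
     (\<exists>j :: nat \<Rightarrow> int.
        (\<forall>l\<in>prime_factors (nat \<bar>m\<bar>). \<bar>j l\<bar> \<le> int (multiplicity l (nat \<bar>m\<bar>) div ord 7 l)) \<and>
        ([(\<Sum>l\<in>prime_factors (nat \<bar>m\<bar>). j l * delta \<omega> l) = 1] (mod 7) \<or>
         [(\<Sum>l\<in>prime_factors (nat \<bar>m\<bar>). j l * delta \<omega> l) = - 1] (mod 7)))}"

definition L11 :: "complex \<Rightarrow> int set" where
  "L11 \<omega> = {m. m \<noteq> 0 \<and> coprime m 7 \<and> (\<exists>l. usable m l \<and> \<not> invisible \<omega> l)}"

definition union_of_congruence_classes :: "int \<Rightarrow> int set \<Rightarrow> bool" where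
  "union_of_congruence_classes N S \<longleftrightarrow> (\<exists>C. S = (\<Union>r\<in>C. {m. [m = r] (mod N)}))"

end

theory Submission
  imports Defs
begin

text \<open>
  Neither set contains 1, so it suffices to find, for each \<open>N\<close>, a prime \<open>l\<close> coprime to \<open>7 N\<close> whose prime
  ideals have nonzero \<open>d\<close>: then a power of \<open>l\<close> that is 1 modulo \<open>N\<close> and has a large exponent lies in both.
  Since \<open>d\<close> turns products into sums, some prime factor of an element with nonzero \<open>d\<close> has nonzero \<open>d\<close>.
  One starts from \<open>1 + c \<omega>\<close> with \<open>c \<equiv> 2\<close> modulo 7 and \<open>c\<close> divisible by the part of \<open>N\<close> prime to 7, which
  makes the rational prime below coprime to \<open>N\<close>.

  That prime factors and generators of ideals exist follows from norm-Euclidean division: an element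
  \<open>\<Sum>i<7. c\<^sub>i \<omega> ^ i\<close> has trace form \<open>7 \<Sum>c\<^sub>i\<^sup>2 - (\<Sum>c\<^sub>i)\<^sup>2\<close>, this form has small covering radius, and the
  inequality of arithmetic and geometric means bounds the norm by it. Up to sign, \<open>d\<close> does not depend on
  the prime ideal above \<open>l\<close> and its generator: the automorphism \<open>\<omega> \<mapsto> \<omega> ^ a\<close> multiplies \<open>c\<^sub>3\<close> by
  \<open>a ^ 3 \<equiv> \<plusminus>1\<close>, and a unit divided by its complex conjugate is, up to sign, a power of \<open>\<omega>\<close>.
\<close>

section \<open>Evaluation and moments of integer polynomials\<close>

definition ev :: "int poly \<Rightarrow> complex \<Rightarrow> complex" where
  "ev p x = poly (map_poly of_int p) x"

lemma ev_0 [simp]: "ev 0 x = 0" by (simp add: ev_def)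

lemma ev_pCons [simp]: "ev (pCons a p) x = of_int a + x * ev p x"
  by (simp add: ev_def map_poly_pCons)

lemma ev_add [simp]: "ev (p + q) x = ev p x + ev q x"
proof (induction p arbitrary: q)
  case (pCons a p)
  obtain b r where "q = pCons b r" by (cases q)
  then show ?case using pCons.IH[of r] by (simp add: algebra_simps)
qed simp

lemma ev_smult [simp]: "ev (Polynomial.smult a q) x = of_int a * ev q x"
  by (induction q) (simp_all add: algebra_simps)

lemma ev_uminus [simp]: "ev (- q) x = - ev q x"
  by (induction q) simp_all

lemma ev_diff [simp]: "ev (p - q) x = ev p x - ev q x"
  using ev_add[of p "- q" x] by simp

lemma ev_mult [simp]: "ev (p * q) x = ev p x * ev q x"
  by (induction p) (simp_all add: algebra_simps)

lemma ev_1 [simp]: "ev 1 x = 1"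
  by (simp add: one_pCons)

lemma ev_power [simp]: "ev (p ^ n) x = ev p x ^ n"
  by (induction n) simp_all

lemma ev_prod [simp]: "ev (prod f S) x = (\<Prod>i\<in>S. ev (f i) x)"
  by (induction S rule: infinite_finite_induct) simp_all

lemma ev_sum [simp]: "ev (sum f S) x = (\<Sum>i\<in>S. ev (f i) x)"
  by (induction S rule: infinite_finite_induct) simp_all

lemma ev_monom [simp]: "ev (Polynomial.monom c n) x = of_int c * x ^ n"
  by (simp add: ev_def poly_monom map_poly_monom)

lemma ev_pcompose [simp]: "ev (pcompose p q) x = ev p (ev q x)"
  by (induction p) (simp_all add: pcompose_pCons)

text \<open>For \<open>a\<close> prime to 7 this is the Galois automorphism
  \<open>w \<mapsto> w ^ a\<close> on polynomial representatives; \<open>a = 6\<close> is complex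
  conjugation.\<close>

definition subst_pow :: "nat \<Rightarrow> int poly \<Rightarrow> int poly" where
  "subst_pow a p = pcompose p (Polynomial.monom 1 a)"

lemma ev_subst_pow [simp]: "ev (subst_pow a p) x = ev p (x ^ a)"
  by (simp add: subst_pow_def)

text \<open>Modulo 7, the moments \<open>\<Sum>i. coeff p i * i ^ k\<close> for \<open>k \<le> 5\<close> are the coordinates of
  \<open>p(\<omega>)\<close> in \<open>A7\<close> with respect to \<open>\<Lambda> ^ k / k!\<close>, because \<open>\<omega> = exp \<Lambda>\<close>.\<close>

definition euler :: "int poly \<Rightarrow> int poly" where
  "euler p = pCons 0 (pderiv p)"

definition moment :: "nat \<Rightarrow> int poly \<Rightarrow> int" where
  "moment k p = poly ((euler ^^ k) p) 1"

lemma euler_add: "euler (p + q) = euler p + euler q"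
  by (simp add: euler_def pderiv_add)

lemma euler_smult: "euler (Polynomial.smult c p) = Polynomial.smult c (euler p)"
  by (simp add: euler_def pderiv_smult)

lemma euler_mult: "euler (p * q) = euler p * q + p * euler q"
  by (simp add: euler_def pderiv_mult algebra_simps)

lemma euler_subst_pow: "euler (subst_pow a p) = Polynomial.smult (int a) (subst_pow a (euler p))"
proof (cases a)
  case (Suc n)
  have "Polynomial.monom (int a) n = Polynomial.smult (int a) (Polynomial.monom 1 n)"
    by (simp add: smult_monom)
  then show ?thesis
    by (simp add: Suc euler_def subst_pow_def pderiv_pcompose pderiv_monom pcompose_pCons)
      (simp add: monom_Suc mult.commute)
qed (simp add: euler_def subst_pow_def monom_0 pcompose_const pderiv_pcompose)

lemma euler_pow_add: "(euler ^^ k) (p + q) = (euler ^^ k) p + (euler ^^ k) q"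
  by (induction k) (simp_all add: euler_add)

lemma euler_pow_smult: "(euler ^^ k) (Polynomial.smult c p) = Polynomial.smult c ((euler ^^ k) p)"
  by (induction k) (simp_all add: euler_smult)

lemma moment_add [simp]: "moment k (p + q) = moment k p + moment k q"
  by (simp add: moment_def euler_pow_add)

lemma moment_smult [simp]: "moment k (Polynomial.smult c p) = c * moment k p"
  by (simp add: moment_def euler_pow_smult)

lemma moment_uminus [simp]: "moment k (- p) = - moment k p"
  using moment_smult[of k "-1" p] by simp

lemma moment_diff [simp]: "moment k (p - q) = moment k p - moment k q"
  using moment_add[of k p "- q"] by simp

lemma moment_0 [simp]: "moment k 0 = 0"
  using moment_smult[of k 0 0] by simp

lemma moment_sum: "moment k (sum f S) = (\<Sum>i\<in>S. moment k (f i))"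
  by (induction S rule: infinite_finite_induct) simp_all

lemma moment_Suc: "moment (Suc k) p = moment k (euler p)"
  by (simp add: moment_def funpow_swap1)

lemmas moment_numeral = moment_Suc[of 0, folded One_nat_def] moment_Suc[of 1, simplified Suc_1]
  moment_Suc[of 2, simplified] moment_Suc[of 3, simplified] moment_Suc[of 4, simplified]

text \<open>The iterated Leibniz rule for the derivation \<open>euler\<close>. Orders up to 5 are
  enough because \<open>A7\<close> has dimension 6 over the field with seven elements.\<close>

lemma moment_mult:
  shows "moment 0 (p * q) = moment 0 p * moment 0 q"
    and "moment 1 (p * q) = moment 1 p * moment 0 q + moment 0 p * moment 1 q"
    and "moment 2 (p * q) = moment 2 p * moment 0 q + 2 * moment 1 p * moment 1 q
      + moment 0 p * moment 2 q"
    and "moment 3 (p * q) = moment 3 p * moment 0 q + 3 * moment 2 p * moment 1 q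
      + 3 * moment 1 p * moment 2 q + moment 0 p * moment 3 q"
    and "moment 4 (p * q) = moment 4 p * moment 0 q + 4 * moment 3 p * moment 1 q
      + 6 * moment 2 p * moment 2 q + 4 * moment 1 p * moment 3 q + moment 0 p * moment 4 q"
    and "moment 5 (p * q) = moment 5 p * moment 0 q + 5 * moment 4 p * moment 1 q
      + 10 * moment 3 p * moment 2 q + 10 * moment 2 p * moment 3 q
      + 5 * moment 1 p * moment 4 q + moment 0 p * moment 5 q"
proof -
  show 0: "moment 0 (p * q) = moment 0 p * moment 0 q" for p q
    by (simp add: moment_def)
  show 1: "moment 1 (p * q) = moment 1 p * moment 0 q + moment 0 p * moment 1 q" for p q
    by (simp only: moment_numeral(1) euler_mult moment_add 0)
  show 2: "moment 2 (p * q) = moment 2 p * moment 0 q + 2 * moment 1 p * moment 1 q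
      + moment 0 p * moment 2 q" for p q
    by (simp only: moment_numeral(2) euler_mult moment_add 1)
      (simp add: algebra_simps flip: moment_numeral moment_numeral(2)[simplified])
  show 3: "moment 3 (p * q) = moment 3 p * moment 0 q + 3 * moment 2 p * moment 1 q
      + 3 * moment 1 p * moment 2 q + moment 0 p * moment 3 q" for p q
    by (simp only: moment_numeral(3) euler_mult moment_add 2)
      (simp add: algebra_simps flip: moment_numeral moment_numeral(2)[simplified])
  show 4: "moment 4 (p * q) = moment 4 p * moment 0 q + 4 * moment 3 p * moment 1 q
      + 6 * moment 2 p * moment 2 q + 4 * moment 1 p * moment 3 q + moment 0 p * moment 4 q" for p q
    by (simp only: moment_numeral(4) euler_mult moment_add 3)
      (simp add: algebra_simps flip: moment_numeral moment_numeral(2)[simplified])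
  show "moment 5 (p * q) = moment 5 p * moment 0 q + 5 * moment 4 p * moment 1 q
      + 10 * moment 3 p * moment 2 q + 10 * moment 2 p * moment 3 q
      + 5 * moment 1 p * moment 4 q + moment 0 p * moment 5 q"
    by (simp only: moment_numeral(5) euler_mult moment_add 4)
      (simp add: algebra_simps flip: moment_numeral moment_numeral(2)[simplified])
qed

lemma moment_subst_pow: "moment k (subst_pow a p) = int a ^ k * moment k p"
proof -
  have "(euler ^^ k) (subst_pow a p) = Polynomial.smult (int a ^ k) (subst_pow a ((euler ^^ k) p))"
    by (induction k) (simp_all add: euler_smult euler_subst_pow mult.commute)
  then show ?thesis
    by (simp add: moment_def subst_pow_def poly_pcompose poly_monom)
qed

lemma moment_const [simp]:
  "moment 0 [:c:] = c" "k > 0 \<Longrightarrow> moment k [:c:] = 0"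
proof -
  show "moment 0 [:c:] = c" by (simp add: moment_def)
  assume "k > 0"
  then obtain n where "k = Suc n" by (cases k) auto
  moreover have "(euler ^^ n) 0 = 0"
    using euler_pow_smult[of n 0 0] by simp
  ultimately show "moment k [:c:] = 0"
    by (simp add: moment_def funpow_swap1 euler_def)
qed

lemma moment_monom: "moment k (Polynomial.monom c n) = c * int n ^ k"
proof -
  have "euler (Polynomial.monom c n) = Polynomial.monom (c * int n) n" for c
    by (cases n) (simp_all add: euler_def pderiv_monom mult.commute flip: monom_Suc)
  then have "(euler ^^ k) (Polynomial.monom c n) = Polynomial.monom (c * int n ^ k) n"
    by (induction k) (simp_all add: ac_simps)
  then show ?thesis by (simp add: moment_def poly_monom)
qed

text \<open>Passing to the logarithm turns moments into cumulants, so \<open>c\<^sub>3\<close> is, up to a unit, the third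
  cumulant. Multiplying by the cube of \<open>moment 0 p\<close> clears the denominators.\<close>

definition cumul3 :: "int poly \<Rightarrow> int" where
  "cumul3 p = (moment 0 p)\<^sup>2 * moment 3 p - 3 * moment 0 p * moment 1 p * moment 2 p
     + 2 * (moment 1 p) ^ 3"

text \<open>The third cumulant is \<open>cumul3 p / (moment 0 p) ^ 3\<close>, and cumulants add
  under products; with denominators cleared this is an exact identity of integers.\<close>

lemma cumul3_mult:
  "cumul3 (p * q) = (moment 0 q) ^ 3 * cumul3 p + (moment 0 p) ^ 3 * cumul3 q"
  unfolding cumul3_def moment_mult
  by (simp add: power2_eq_square power3_eq_cube algebra_simps)

lemma cumul3_subst_pow: "cumul3 (subst_pow a p) = int a ^ 3 * cumul3 p"
  unfolding cumul3_def moment_subst_pow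
  by (simp add: power2_eq_square power3_eq_cube algebra_simps)

section \<open>The norm\<close>

locale root7 =
  fixes w :: complex
  assumes pow7: "w ^ 7 = 1" and primitive: "\<forall>k\<in>{1..<7::nat}. w ^ k \<noteq> 1"
begin

lemma pow_mod7: "w ^ n = w ^ (n mod 7)"
proof -
  have "w ^ n = w ^ (7 * (n div 7) + n mod 7)" by simp
  then show ?thesis by (simp only: power_add power_mult pow7) simp
qed

lemma pow_eq_1_iff: "w ^ n = 1 \<longleftrightarrow> 7 dvd n"
proof
  assume "w ^ n = 1"
  then have "w ^ (n mod 7) = 1" using pow_mod7 by simp
  then have "n mod 7 \<notin> {1..<7}" using primitive by blast
  then have "n mod 7 = 0" using mod_less_divisor[of 7 n] by simp
  then show "7 dvd n" by presburger
next
  assume "7 dvd n"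
  then show "w ^ n = 1" by (subst pow_mod7) simp
qed

lemma pow_pow_7: "(w ^ n) ^ 7 = 1"
  by (metis power_commutes power_mult mult.commute pow7 power_one)

lemma sum_powers: "(\<Sum>b<7. (w ^ n) ^ b) = (if 7 dvd n then 7 else 0)"
proof (cases "7 dvd n")
  case True
  then show ?thesis using pow_eq_1_iff[of n] by simp
next
  case False
  then have "w ^ n \<noteq> 1" using pow_eq_1_iff by simp
  then show ?thesis using False pow_pow_7[of n] by (simp add: geometric_sum)
qed

lemma norm_w: "norm w = 1"
proof -
  have "norm w ^ 7 = 1 ^ 7" using pow7 by (metis norm_one norm_power power_one)
  then show ?thesis by (rule power_eq_imp_eq_base) auto
qed

lemma cnj_w: "cnj w = w ^ 6"
proof -
  have "w * cnj w = 1" using norm_w by (simp add: complex_norm_square[symmetric])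
  moreover have "w * w ^ 6 = 1" using pow7 by (simp add: eval_nat_numeral)
  moreover have "w \<noteq> 0" using norm_w by auto
  ultimately show ?thesis by (metis mult_left_cancel)
qed

lemma ev_at_1: "ev p 1 = of_int (moment 0 p)"
  by (induction p) (simp_all add: moment_def)

lemma cnj_ev: "cnj (ev p x) = ev p (cnj x)"
  by (induction p) simp_all

lemma cnj_ev_pow: "cnj (ev p (w ^ a)) = ev p (w ^ (6 * a))"
  by (simp add: cnj_ev cnj_w power_mult)

lemma ev_high_powers:
  "ev p (w ^ 4) = cnj (ev p (w ^ 3))"
  "ev p (w ^ 5) = cnj (ev p (w ^ 2))"
  "ev p (w ^ 6) = cnj (ev p w)"
  using cnj_ev_pow[of p 3] cnj_ev_pow[of p 2] cnj_ev_pow[of p 1]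
    pow_mod7[of 18] pow_mod7[of 12] by simp_all

text \<open>Reduction modulo \<open>x ^ 7 - 1\<close>: one coefficient vector serves all seven roots
  of unity, 1 included, as Fourier inversion requires.\<close>

lemma coords_exist:
  obtains c :: "nat \<Rightarrow> int" where "\<And>x. x ^ 7 = 1 \<Longrightarrow> ev p x = (\<Sum>i<7. of_int (c i) * x ^ i)"
proof -
  have "\<exists>c :: nat \<Rightarrow> int. \<forall>x. x ^ 7 = 1 \<longrightarrow> ev p x = (\<Sum>i<7. of_int (c i) * x ^ i)"
  proof (induction p)
    case 0
    show ?case by (rule exI[of _ "\<lambda>_. 0"]) simp
  next
    case (pCons a p)
    then obtain c :: "nat \<Rightarrow> int"
      where c: "\<And>x. x ^ 7 = 1 \<Longrightarrow> ev p x = (\<Sum>i<7. of_int (c i) * x ^ i)" by auto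
    \<comment> \<open>Multiplication by \<open>x\<close> shifts cyclically, so the top coefficient
      \<open>c 6\<close> wraps round to the constant term.\<close>
    define d where "d i = (if i = 0 then a + c 6 else c (i - 1))" for i
    have "ev (pCons a p) x = (\<Sum>i<7. of_int (d i) * x ^ i)" if "x ^ 7 = 1" for x
    proof -
      have "x ^ 7 * of_int (c 6) = of_int (c 6)" using that by simp
      then show ?thesis
        using c[OF that] by (simp add: d_def eval_nat_numeral algebra_simps)
    qed
    then show ?case by auto
  qed
  then show ?thesis using that by auto
qed

text \<open>Orthogonality of the characters of the cyclic group of order 7; the exponent
  \<open>7 - j\<close> stands for \<open>- j\<close>.\<close>

lemma fourier_inversion:
  assumes "j < 7"
  shows "(\<Sum>b<7. w ^ (b * (7 - j)) * (\<Sum>i<7. of_int (c i) * (w ^ b) ^ i)) = 7 * of_int (c j)"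
proof -
  have "(\<Sum>b<7. w ^ (b * (7 - j)) * (\<Sum>i<7. of_int (c i) * (w ^ b) ^ i)) =
      (\<Sum>b<7. \<Sum>i<7. of_int (c i) * (w ^ (7 - j + i)) ^ b)"
  proof (intro sum.cong refl, unfold sum_distrib_left, intro sum.cong refl)
    fix b i :: nat
    have "(w ^ (7 - j + i)) ^ b = w ^ (b * (7 - j)) * (w ^ b) ^ i"
      by (simp add: distrib_left mult.commute add.commute flip: power_mult power_add)
    then show "w ^ (b * (7 - j)) * (of_int (c i) * (w ^ b) ^ i) = of_int (c i) * (w ^ (7 - j + i)) ^ b"
      by simp
  qed
  also have "\<dots> = (\<Sum>i<7. of_int (c i) * (\<Sum>b<7. (w ^ (7 - j + i)) ^ b))"
    by (subst sum.swap) (simp add: sum_distrib_left)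
  also have "\<dots> = (\<Sum>i<7. if i = j then 7 * of_int (c i) else 0)"
  proof (rule sum.cong)
    fix i :: nat assume "i \<in> {..<7}"
    then have "7 dvd 7 - j + i \<longleftrightarrow> i = j" using assms by (auto, presburger)
    then show "of_int (c i) * (\<Sum>b<7. (w ^ (7 - j + i)) ^ b) = (if i = j then 7 * of_int (c i) else 0)"
      by (simp add: sum_powers)
  qed simp
  also have "\<dots> = 7 * of_int (c j)" using assms by simp
  finally show ?thesis .
qed

definition norm_prod :: "int poly \<Rightarrow> complex" where
  "norm_prod p = (\<Prod>a=1..6. ev p (w ^ a))"

lemma norm_prod_conj:
  assumes "b \<in> {1..6}"
  shows "(\<Prod>a=1..6. ev p ((w ^ b) ^ a)) = norm_prod p"
proof -
  have set: "{1..6::nat} = {1,2,3,4,5,6}" by auto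
  have "bij_betw (\<lambda>a. a * b mod 7) {1..6} {1..6}"
    using assms unfolding set by (elim insertE) (auto simp: bij_betw_def)
  then have "norm_prod p = (\<Prod>a=1..6. ev p (w ^ (a * b mod 7)))"
    unfolding norm_prod_def by (rule prod.reindex_bij_betw[symmetric])
  also have "\<dots> = (\<Prod>a=1..6. ev p ((w ^ b) ^ a))"
    by (simp add: power_mult[symmetric] mult.commute flip: pow_mod7)
  finally show ?thesis by simp
qed

text \<open>The product \<open>Q\<close> of all conjugates takes the value
  \<open>norm_prod p\<close> at the six nontrivial roots and \<open>(moment 0 p) ^ 6\<close> at 1.
  By Fourier inversion the norm is \<open>c 0 - c 1\<close>, while \<open>7 * c 1\<close> is the
  difference of the two values.\<close>

lemma norm_prod_int:
  obtains n k :: int where "norm_prod p = of_int n" "n = moment 0 p ^ 6 - 7 * k"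
proof -
  define Q where "Q = (\<Prod>a=1..6. subst_pow a p)"
  obtain c where c: "\<And>x. x ^ 7 = 1 \<Longrightarrow> ev Q x = (\<Sum>i<7. of_int (c i) * x ^ i)"
    using coords_exist[of Q] by metis
  have Q: "ev Q (w ^ b) = norm_prod p" if "b \<in> {1..6}" for b
    using norm_prod_conj[OF that] by (simp add: Q_def)
  have Q1: "ev Q 1 = of_int (moment 0 p) ^ 6"
  proof -
    have "ev Q 1 = ev p 1 ^ 6" by (simp add: Q_def)
    then show ?thesis by (simp add: ev_at_1)
  qed
  have four: "7 * of_int (c j) = (\<Sum>b<7. w ^ (b * (7 - j)) * ev Q (w ^ b))" if "j < 7" for j
    using fourier_inversion[OF that, of c] c[OF pow_pow_7] by simp
  have split: "(\<Sum>b<7. f b) = f 0 + (\<Sum>b=1..6. f b)" for f :: "nat \<Rightarrow> complex"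
    by (simp add: eval_nat_numeral)
  have S: "7 * of_int (c j) = of_int (moment 0 p) ^ 6 + norm_prod p * (\<Sum>b=1..6. w ^ (b * (7 - j)))"
    if "j < 7" for j
    using four[OF that] Q Q1 by (subst (asm) split) (simp add: sum_distrib_left mult_ac)
  have "(\<Sum>b<7. w ^ (b * 6)) = 0"
    using sum_powers[of 6] by (simp add: mult.commute flip: power_mult)
  then have s6: "(\<Sum>b=1..6. w ^ (b * 6)) = -1" by (subst (asm) split) (simp add: eq_neg_iff_add_eq_0 add.commute)
  have s0: "(\<Sum>b=1..6. w ^ (b * 7)) = 6"
  proof -
    have "w ^ (b * 7) = 1" for b using pow_eq_1_iff by simp
    then show ?thesis by simp
  qed
  have "7 * of_int (c 0) = of_int (moment 0 p) ^ 6 + norm_prod p * 6"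
    using S[of 0] s0 by simp
  moreover have c1: "7 * of_int (c 1) = of_int (moment 0 p) ^ 6 - norm_prod p"
    using S[of 1] s6 by simp
  ultimately have "7 * norm_prod p = 7 * (of_int (c 0) - of_int (c 1))"
    by (simp only: right_diff_distrib) simp
  then have C: "norm_prod p = of_int (c 0 - c 1)"
    by (subst (asm) mult_left_cancel) simp_all
  from c1 C have "complex_of_int (7 * c 1) = of_int (moment 0 p ^ 6 - (c 0 - c 1))"
    by (simp only: of_int_mult of_int_diff of_int_power) simp
  then have "7 * c 1 = moment 0 p ^ 6 - (c 0 - c 1)" by (simp only: of_int_eq_iff)
  with C show ?thesis using that[of "c 0 - c 1" "c 1"] by simp
qed

text \<open>The product of conjugates is already an integer, so the floor of its real part only
  changes the type.\<close>

definition nrm :: "int poly \<Rightarrow> int" where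
  "nrm p = \<lfloor>Re (norm_prod p)\<rfloor>"

lemma of_int_nrm: "of_int (nrm p) = norm_prod p"
  proof -
  obtain n k where "norm_prod p = of_int n" "n = moment 0 p ^ 6 - 7 * k" by (rule norm_prod_int)
  then show ?thesis by (simp add: nrm_def del: of_int_diff of_int_mult of_int_power)
qed

lemma nrm_cong: "[nrm p = moment 0 p ^ 6] (mod 7)"
proof -
  obtain n k where "norm_prod p = of_int n" "n = moment 0 p ^ 6 - 7 * k" by (rule norm_prod_int)
  then have "nrm p = moment 0 p ^ 6 - 7 * k" using of_int_nrm[of p] by (metis of_int_eq_iff)
  then show ?thesis by (simp add: cong_iff_dvd_diff)
qed

text \<open>The exponents 4, 5, 6 give the complex conjugates of the values at 3, 2, 1, so the six
  factors pair up into squared absolute values.\<close>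

lemma nrm_norm: "real_of_int (nrm p) = (norm (ev p w) * norm (ev p (w ^ 2)) * norm (ev p (w ^ 3)))\<^sup>2"
proof -
  have set: "{1..6::nat} = {1,2,3,4,5,6}" by auto
  have "complex_of_real (real_of_int (nrm p)) = norm_prod p" by (simp add: of_int_nrm)
  also have "\<dots> = (ev p w * cnj (ev p w)) * (ev p (w ^ 2) * cnj (ev p (w ^ 2))) * (ev p (w ^ 3) * cnj (ev p (w ^ 3)))"
    unfolding norm_prod_def set by (simp add: ev_high_powers)
  also have "\<dots> = complex_of_real ((norm (ev p w) * norm (ev p (w ^ 2)) * norm (ev p (w ^ 3)))\<^sup>2)"
    by (simp add: complex_norm_square[symmetric] power_mult_distrib)
  finally show ?thesis by (simp only: of_real_eq_iff)
qed

lemma nrm_nonneg: "nrm p \<ge> 0"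
proof -
  have "real_of_int (nrm p) \<ge> 0" unfolding nrm_norm by simp
  then show ?thesis by simp
qed

lemma nrm_mult: "nrm (p * q) = nrm p * nrm q"
proof -
  have "complex_of_int (nrm (p * q)) = of_int (nrm p * nrm q)"
    by (simp add: of_int_nrm norm_prod_def prod.distrib)
  then show ?thesis by (simp only: of_int_eq_iff)
qed

lemma ev_root_imp_7_dvd:
  assumes "ev p w = 0"
  shows "7 dvd moment 0 p"
proof -
  have "norm_prod p = 0" unfolding norm_prod_def using assms by (auto intro!: bexI[of _ 1])
  then have "nrm p = 0" by (simp add: nrm_def)
  then have "7 dvd moment 0 p ^ 6" using nrm_cong[of p] by (simp add: cong_iff_dvd_diff)
  then show ?thesis by (rule prime_dvd_power[rotated]) simp
qed

end

section \<open>Divisibility by the cyclotomic polynomial\<close>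

definition Phi7 :: "int poly" where
  "Phi7 = [:1, 1, 1, 1, 1, 1, 1:]"

lemma Phi7_nz [simp]: "Phi7 \<noteq> 0" and degree_Phi7: "Polynomial.degree Phi7 = 6"
  and lead_coeff_Phi7: "Polynomial.coeff Phi7 6 = 1"
  by (simp_all add: Phi7_def eval_nat_numeral)

lemma moment_Phi7: "k \<le> 5 \<Longrightarrow> 7 dvd moment k Phi7"
proof -
  have eq: "Phi7 = (\<Sum>i<7. Polynomial.monom 1 i)"
    by (simp add: Phi7_def eval_nat_numeral monom_Suc monom_0 one_pCons)
  have *: "moment k Phi7 = (\<Sum>i<7. int i ^ k)"
    by (subst eq) (simp add: moment_sum moment_monom)
  assume "k \<le> 5"
  then have "k \<in> {0,1,2,3,4,5}" by auto
  then show ?thesis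
    unfolding * by (auto simp: eval_nat_numeral)
qed

text \<open>Total ramification of 7: modulo 7 the cyclotomic polynomial is the sixth power of
  \<open>x - 1\<close>.\<close>

lemma linear_power_6: "[:-1, 1:] ^ 6 = Phi7 + Polynomial.smult 7 [:0, -1, 2, -3, 2, -1:]"
  by (simp add: Phi7_def eval_nat_numeral)

text \<open>\<open>Phi7\<close> is monic, so pseudo-division is genuine division over the
  integers.\<close>

lemma division_by_Phi7:
  obtains q r where "p = Phi7 * q + r" "r = 0 \<or> Polynomial.degree r < 6"
proof -
  obtain q r where qr: "pseudo_divmod p Phi7 = (q, r)" by fastforce
  show ?thesis
    using that[of q r] pseudo_divmod[OF Phi7_nz qr] by (simp add: degree_Phi7 lead_coeff_Phi7)
qed

lemma moment_0_eq_poly: "moment 0 p = poly p 1"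
  by (simp add: moment_def)

lemma linear_factor:
  assumes "7 dvd moment 0 p"
  obtains q n where "p = [:-1, 1:] * q + [:7 * n:]"
proof -
  obtain n where "moment 0 p = 7 * n" using assms by blast
  then have "poly (p - [:7 * n:]) 1 = 0" by (simp add: moment_0_eq_poly)
  then have "[:-1, 1:] dvd p - [:7 * n:]" by (simp only: poly_eq_0_iff_dvd)
  then obtain q where "p - [:7 * n:] = [:-1, 1:] * q" by blast
  then show ?thesis using that[of q n] by (simp add: algebra_simps)
qed

text \<open>At 1 only the term survives in which each of the \<open>n\<close> derivations removes
  one factor \<open>x - 1\<close>.\<close>

lemma moment_linear_power: "moment n ([:-1, 1:] ^ n * q) = fact n * moment 0 q"
proof (induction n arbitrary: q)
  case (Suc n)
  have "pderiv ([:-1, 1:] ^ Suc n) = Polynomial.smult (int (Suc n)) ([:-1, 1 :: int:] ^ n)"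
    by (simp only: pderiv_power_Suc) (simp add: pderiv_pCons)
  then have "euler ([:-1, 1:] ^ Suc n) = Polynomial.smult (int (Suc n)) ([:0, 1:] * [:-1, 1:] ^ n)"
    by (simp only: euler_def) simp
  then have "euler ([:-1, 1:] ^ Suc n * q) =
      [:-1, 1:] ^ n * (Polynomial.smult (int (Suc n)) ([:0, 1:] * q) + [:-1, 1:] * euler q)"
    unfolding euler_mult by (simp only: power_Suc mult_smult_left mult_smult_right distrib_left mult_ac)
  then show ?case
    by (simp only: moment_Suc Suc.IH) (simp add: moment_mult(1) moment_0_eq_poly algebra_simps)
qed simp

text \<open>Modulo 7 each vanishing moment splits off one more factor \<open>x - 1\<close>, because
  \<open>fact n\<close> is a unit for \<open>n \<le> 5\<close>. Six such factors make up
  \<open>Phi7\<close>.\<close>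

lemma moment_kernel:
  assumes "\<And>k. k \<le> 5 \<Longrightarrow> 7 dvd moment k p"
  obtains q r where "p = Phi7 * q + Polynomial.smult 7 r"
proof -
  have "\<exists>q r. p = [:-1, 1:] ^ n * q + Polynomial.smult 7 r" if "n \<le> 6" for n
    using that
  proof (induction n)
    case 0
    show ?case by (rule exI[of _ p], rule exI[of _ 0]) simp
  next
    case (Suc n)
    then obtain q r where p: "p = [:-1, 1:] ^ n * q + Polynomial.smult 7 r" by auto
    have "7 dvd moment n p" using assms Suc.prems by simp
    then have "7 dvd fact n * moment 0 q"
      by (simp add: p moment_linear_power dvd_add_left_iff)
    moreover have "\<not> 7 dvd (fact n :: int)"
    proof -
      have "n \<in> {0,1,2,3,4,5}" using Suc.prems by auto
      then show ?thesis by (auto simp: fact_numeral)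
    qed
    ultimately have "7 dvd moment 0 q"
      using prime_dvd_multD[of "7::int" "fact n" "moment 0 q"] by simp
    then obtain q' m where q': "q = [:-1, 1:] * q' + [:7 * m:]" by (rule linear_factor)
    have "p = [:-1, 1:] ^ Suc n * q' + Polynomial.smult 7 (r + [:-1, 1:] ^ n * [:m:])"
      by (subst p, subst q') (simp add: algebra_simps smult_add_right)
    then show ?case by blast
  qed
  from this[of 6] obtain q r where "p = [:-1, 1:] ^ 6 * q + Polynomial.smult 7 r" by auto
  moreover obtain h where "[:-1, 1:] ^ 6 = Phi7 + Polynomial.smult 7 h" using linear_power_6 by blast
  ultimately have "p = Phi7 * q + Polynomial.smult 7 (h * q + r)"
    by (simp add: algebra_simps smult_add_right)
  then show ?thesis by (rule that)
qed

lemma inverse_mod_7: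
  assumes "a \<in> {1..6::nat}"
  obtains b where "a * b mod 7 = 1" "\<not> 7 dvd b"
proof -
  have "a \<in> {1,2,3,4,5,6}" using assms by auto
  then have "\<exists>b\<in>{1,2,3,4,5,6}. a * b mod 7 = 1" by (elim insertE) simp_all
  then obtain b where "b \<in> {1,2,3,4,5,6}" and b: "a * b mod 7 = 1" by blast
  then have "\<not> 7 dvd b" by auto
  with b show ?thesis by (rule that)
qed

section \<open>Polynomials vanishing at \<open>w\<close>\<close>

context root7
begin

lemma w_neq_1: "w \<noteq> 1"
  using primitive by (metis atLeastLessThan_iff one_less_numeral_iff order_refl power_one_right semiring_norm(77))

lemma ev_Phi7: "\<not> 7 dvd a \<Longrightarrow> ev Phi7 (w ^ a) = 0"
  using sum_powers[of a] by (simp add: Phi7_def eval_nat_numeral algebra_simps)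

lemma ev_Phi7_w [simp]: "ev Phi7 w = 0"
  using ev_Phi7[of 1] by simp

text \<open>A polynomial that vanishes at \<open>w\<close> has a value at 1 divisible by
  \<open>7\<close>, which is the value of \<open>Phi7\<close> there. Subtracting a multiple of
  \<open>Phi7\<close> makes it divisible by \<open>x - 1\<close>, and the cofactor still vanishes at
  \<open>w\<close>.\<close>

lemma ev_root_factor:
  assumes "ev p w = 0"
  shows "\<exists>q r. ev q w = 0 \<and> p = [:-1, 1:] ^ k * q + Phi7 * r"
proof (induction k)
  case 0
  show ?case by (rule exI[of _ p], rule exI[of _ 0]) (simp add: assms)
next
  case (Suc k)
  then obtain q r where q: "ev q w = 0" "p = [:-1, 1:] ^ k * q + Phi7 * r" by blast
  obtain n where n: "moment 0 q = 7 * n" using ev_root_imp_7_dvd[OF q(1)] by blast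
  then have "poly (q - Polynomial.smult n Phi7) 1 = 0" by (simp add: moment_0_eq_poly Phi7_def)
  then have "[:-1, 1:] dvd q - Polynomial.smult n Phi7" by (simp only: poly_eq_0_iff_dvd)
  then obtain q' where q': "q - Polynomial.smult n Phi7 = [:-1, 1:] * q'" by blast
  then have "ev (q - Polynomial.smult n Phi7) w = ev ([:-1, 1:] * q') w" by simp
  then have "(w - 1) * ev q' w = 0" using q(1) by (simp add: algebra_simps)
  then have "ev q' w = 0" using w_neq_1 by simp
  moreover have qq': "q = [:-1, 1:] * q' + Polynomial.smult n Phi7" using q' by (simp add: algebra_simps)
  have "p = [:-1, 1:] ^ Suc k * q' + Phi7 * (r + Polynomial.smult n ([:-1, 1:] ^ k))"
    by (subst q(2), subst qq') (simp add: algebra_simps)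
  ultimately show ?case by blast
qed

text \<open>Modulo \<open>Phi7\<close>, six factors \<open>x - 1\<close> amount to a factor
  7.\<close>

lemma ev_root_divisible:
  assumes "ev p w = 0"
  shows "\<exists>q r. ev q w = 0 \<and> p = Polynomial.smult (7 ^ n) q + Phi7 * r"
proof (induction n)
  case 0
  show ?case by (rule exI[of _ p], rule exI[of _ 0]) (simp add: assms)
next
  case (Suc n)
  then obtain q r where q: "ev q w = 0" "p = Polynomial.smult (7 ^ n) q + Phi7 * r" by blast
  obtain q' r' where q': "ev q' w = 0" "q = [:-1, 1:] ^ 6 * q' + Phi7 * r'"
    using ev_root_factor[OF q(1)] by blast
  define h :: "int poly" where "h = [:0, -1, 2, -3, 2, -1:]"
  have "p = Polynomial.smult (7 ^ Suc n) (h * q') + Phi7 * (r + Polynomial.smult (7 ^ n) (r' + q'))"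
    unfolding q(2) q'(2) linear_power_6 h_def[symmetric] by (simp add: algebra_simps smult_add_right)
  moreover have "ev (h * q') w = 0" using q'(1) by simp
  ultimately show ?case by blast
qed

text \<open>By 7-adic descent: the remainder modulo \<open>Phi7\<close> is divisible by every power
  of 7 and is therefore 0. Thus \<open>Phi7\<close> generates the kernel of evaluation at
  \<open>w\<close>.\<close>

lemma ev_eq_0_imp_dvd:
  assumes "ev p w = 0"
  shows "Phi7 dvd p"
proof -
  obtain q r where p: "p = Phi7 * q + r" and r: "r = 0 \<or> Polynomial.degree r < 6"
    by (rule division_by_Phi7)
  have "7 ^ n dvd Polynomial.coeff r i" for n i
  proof -
    have "ev r w = 0" using assms p by simp
    then obtain q' r' where q': "r = Polynomial.smult (7 ^ n) q' + Phi7 * r'"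
      using ev_root_divisible by blast
    obtain a b where ab: "q' = Phi7 * a + b" "b = 0 \<or> Polynomial.degree b < 6"
      by (rule division_by_Phi7)
    have eq: "r - Polynomial.smult (7 ^ n) b = Phi7 * (r' + Polynomial.smult (7 ^ n) a)"
      by (simp add: q' ab(1) algebra_simps smult_add_right)
    have "Polynomial.degree (r - Polynomial.smult (7 ^ n) b) < 6"
      using r ab(2) by (intro degree_diff_less) auto
    then have "r' + Polynomial.smult (7 ^ n) a = 0"
      unfolding eq using degree_mult_eq[OF Phi7_nz] degree_Phi7 by fastforce
    then have "r = Polynomial.smult (7 ^ n) b" using eq by simp
    then show ?thesis by simp
  qed
  moreover have "x = 0" if "\<And>n. 7 ^ n dvd x" for x :: int
  proof (rule ccontr)
    assume "x \<noteq> 0"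
    then have "(7::int) ^ nat \<bar>x\<bar> \<le> \<bar>x\<bar>"
      using dvd_imp_le_int[OF _ that[of "nat \<bar>x\<bar>"]] by simp
    moreover have "int n < 7 ^ n" for n
    proof -
      have "int n < int (7 ^ n)" using power_gt_expt[of 7 n] by (simp only: of_nat_less_iff)
      then show ?thesis by simp
    qed
    from this[of "nat \<bar>x\<bar>"] have "\<bar>x\<bar> < 7 ^ nat \<bar>x\<bar>" by simp
    ultimately show False by linarith
  qed
  ultimately have "r = 0" by (intro poly_eqI) simp
  then show ?thesis using p by simp
qed

text \<open>This makes \<open>w \<mapsto> w ^ a\<close> well defined on values rather than on
  representatives.\<close>

lemma ev_eq_conj:
  assumes "ev p w = ev q w" "\<not> 7 dvd a"
  shows "ev p (w ^ a) = ev q (w ^ a)"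
proof -
  obtain r where "p - q = Phi7 * r" using ev_eq_0_imp_dvd[of "p - q"] assms(1) by auto
  then have "ev (p - q) (w ^ a) = ev (Phi7 * r) (w ^ a)" by simp
  then show ?thesis using ev_Phi7[OF assms(2)] by simp
qed

text \<open>Two representatives differ by a multiple of \<open>Phi7\<close>, whose moments up to
  order 5 vanish modulo 7; the Leibniz rule passes this on to its multiples.\<close>

lemma moment_cong:
  assumes "ev p w = ev q w" "k \<le> 5"
  shows "[moment k p = moment k q] (mod 7)"
proof -
  obtain r where "p - q = Phi7 * r" using ev_eq_0_imp_dvd[of "p - q"] assms(1) by auto
  then have "moment k p - moment k q = moment k (Phi7 * r)" by (metis moment_diff)
  also have "7 dvd \<dots>"
  proof -
    have D: "7 dvd moment i Phi7 * x" "7 dvd c * moment i Phi7 * x" if "i \<le> 5" for i c x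
      using moment_Phi7[OF that] by simp_all
    have "k \<in> {0,1,2,3,4,5}" using assms(2) by auto
    then show ?thesis
      by (elim insertE) (simp_all only: moment_mult empty_iff, (intro dvd_add D; simp)+)
  qed
  finally show ?thesis by (simp add: cong_iff_dvd_diff)
qed

lemma cumul3_cong:
  assumes "ev p w = ev q w"
  shows "[cumul3 p = cumul3 q] (mod 7)"
  unfolding cumul3_def
  by (intro cong_add cong_diff cong_mult cong_pow cong_refl moment_cong assms) simp_all

text \<open>If some conjugate vanishes, the inverse automorphism carries the zero back to
  \<open>w\<close>.\<close>

lemma nrm_eq_0_iff: "nrm p = 0 \<longleftrightarrow> ev p w = 0"
proof
  assume "nrm p = 0"
  then have "norm_prod p = 0" using of_int_nrm[of p] by simp
  then obtain a where a: "a \<in> {1..6}" "ev p (w ^ a) = 0" by (auto simp: norm_prod_def)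
  obtain b where b: "a * b mod 7 = 1" "\<not> 7 dvd b" using inverse_mod_7[OF a(1)] .
  have "ev (subst_pow a p) w = ev 0 w" using a(2) by simp
  from ev_eq_conj[OF this b(2)] have "ev p ((w ^ b) ^ a) = 0" by simp
  moreover have "(w ^ b) ^ a = w"
    by (metis b(1) mult.commute pow_mod7 power_mult power_one_right)
  ultimately show "ev p w = 0" by simp
next
  assume "ev p w = 0"
  then have "norm_prod p = 0" unfolding norm_prod_def by (auto intro!: bexI[of _ 1])
  then show "nrm p = 0" by (simp add: nrm_def)
qed

lemma nrm_cong_ev: "ev p w = ev q w \<Longrightarrow> nrm p = nrm q"
proof -
  assume "ev p w = ev q w"
  then have "norm_prod p = norm_prod q"
    unfolding norm_prod_def by (intro prod.cong refl ev_eq_conj) auto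
  then show ?thesis by (simp add: nrm_def)
qed

end

section \<open>Euclidean division and units\<close>

text \<open>The sum of the squared absolute values over the six complex embeddings, see
  \<open>parseval\<close>. Adding one constant to all coordinates does not change it, in accordance
  with the vanishing of \<open>Phi7\<close> at \<open>w\<close>.\<close>

definition energy :: "(nat \<Rightarrow> int) \<Rightarrow> int" where
  "energy c = 7 * (\<Sum>i<7. (c i)\<^sup>2) - (\<Sum>i<7. c i)\<^sup>2"

lemma energy_centered: "7 * energy c = (\<Sum>i<7. (7 * c i - (\<Sum>j<7. c j))\<^sup>2)"
proof -
  define W where "W = (\<Sum>j<7. c j)"
  have "(\<Sum>i<7. (7 * c i - W)\<^sup>2) = (\<Sum>i<7. 49 * (c i)\<^sup>2 - 14 * W * c i + W\<^sup>2)"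
    by (intro sum.cong) (simp_all add: power2_eq_square algebra_simps)
  also have "\<dots> = 49 * (\<Sum>i<7. (c i)\<^sup>2) - 14 * W * W + 7 * W\<^sup>2"
    by (simp add: sum.distrib sum_subtractf W_def flip: sum_distrib_left)
  finally show ?thesis
    by (simp add: energy_def power2_eq_square flip: W_def)
qed

lemma energy_nonneg: "energy c \<ge> 0"
proof -
  have "0 \<le> 7 * energy c" unfolding energy_centered by (intro sum_nonneg) simp
  then show ?thesis by simp
qed

text \<open>The coefficient \<open>card S * (7 - card S)\<close> is the energy of the indicator
  function of \<open>S\<close>, and the linear term is twice the associated bilinear form.\<close>

lemma energy_shift:
  assumes "S \<subseteq> {..<7}"
  shows "energy (\<lambda>i. c i + (if i \<in> S then t else 0)) =
    energy c + t * (2 * (\<Sum>i\<in>S. 7 * c i - (\<Sum>j<7. c j)) + t * (int (card S) * (7 - int (card S))))"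
proof -
  define W where "W = (\<Sum>j<7. c j)"
  define T where "T = (\<Sum>i\<in>S. c i)"
  have fin: "finite S" using assms finite_subset by blast
  have restrict: "(\<Sum>i<7. if i \<in> S then f i else 0) = (\<Sum>i\<in>S. f i)" for f :: "nat \<Rightarrow> int"
    using assms by (simp add: sum.inter_restrict[symmetric] Int_absorb1)
  have "(\<Sum>i<7. (c i + (if i \<in> S then t else 0))\<^sup>2) =
      (\<Sum>i<7. (c i)\<^sup>2 + (if i \<in> S then 2 * t * c i + t\<^sup>2 else 0))"
    by (intro sum.cong) (simp_all add: power2_eq_square algebra_simps)
  also have "\<dots> = (\<Sum>i<7. (c i)\<^sup>2) + 2 * t * T + t\<^sup>2 * int (card S)"
    by (simp add: sum.distrib restrict T_def sum_distrib_left)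
  finally have sq: "(\<Sum>i<7. (c i + (if i \<in> S then t else 0))\<^sup>2) =
    (\<Sum>i<7. (c i)\<^sup>2) + 2 * t * T + t\<^sup>2 * int (card S)" .
  have lin: "(\<Sum>i<7. c i + (if i \<in> S then t else 0)) = W + t * int (card S)"
    by (simp add: sum.distrib restrict W_def)
  have sumS: "(\<Sum>i\<in>S. 7 * c i - W) = 7 * T - int (card S) * W"
    by (simp add: sum_subtractf T_def sum_distrib_left)
  then show ?thesis
    unfolding energy_def sq lin W_def[symmetric] sumS
    by (simp add: power2_eq_square algebra_simps)
qed

text \<open>At a minimum of the energy over the coset, no shift by a subset of the coordinates lowers
  it. The subsets with one element and the set of coordinates below the mean suffice.\<close>

lemma energy_covering:
  assumes n: "n > 0"
  obtains y :: "nat \<Rightarrow> int" where "energy (\<lambda>i. x i - n * y i) < 6 * n\<^sup>2"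
proof -
  obtain y where min: "\<And>z. nat (energy (\<lambda>i. x i - n * y i)) \<le> nat (energy (\<lambda>i. x i - n * z i))"
    using ex_has_least_nat[of "\<lambda>_. True" _ "\<lambda>y. nat (energy (\<lambda>i. x i - n * y i))"] by blast
  define c where "c i = x i - n * y i" for i
  define u where "u i = 7 * c i - (\<Sum>j<7. c j)" for i
  have shift: "0 \<le> e * (2 * (\<Sum>i\<in>S. u i)) + n * (int (card S) * (7 - int (card S)))"
    if S: "S \<subseteq> {..<7}" and e: "e = 1 \<or> e = -1" for S e
  proof -
    have ee: "e * e = 1" using e by auto
    have "(\<lambda>i. c i + (if i \<in> S then e * n else 0)) = (\<lambda>i. x i - n * (y i - (if i \<in> S then e else 0)))"
      by (auto simp: c_def algebra_simps)
    then have "energy c \<le> energy (\<lambda>i. c i + (if i \<in> S then e * n else 0))"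
      using min[of "\<lambda>i. y i - (if i \<in> S then e else 0)"] energy_nonneg
      by (simp add: c_def[abs_def] nat_le_eq_zle)
    then have "0 \<le> e * n * (2 * (\<Sum>i\<in>S. u i) + e * n * (int (card S) * (7 - int (card S))))"
      unfolding energy_shift[OF S] u_def by simp
    also have "\<dots> = n * (e * (2 * (\<Sum>i\<in>S. u i)) + (e * e) * (n * (int (card S) * (7 - int (card S)))))"
      by (simp add: algebra_simps)
    finally show ?thesis using n by (simp add: ee zero_le_mult_iff)
  qed
  \<comment> \<open>A singleton has \<open>card S * (7 - card S) = 6\<close>; both signs of the
    shift bound \<open>u i\<close> on both sides.\<close>
  have u_le: "\<bar>u i\<bar> \<le> 3 * n" if "i < 7" for i
    using shift[of "{i}" 1] shift[of "{i}" "-1"] that by simp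
  define S where "S = {i. i < 7 \<and> u i < 0}"
  have S: "S \<subseteq> {..<7}" "finite S" by (auto simp: S_def)
  have "int (card S) * (7 - int (card S)) \<le> 12"
  proof -
    have "card S \<le> 7" using card_mono[OF _ S(1)] by simp
    then have "card S \<in> {0,1,2,3,4,5,6,7}" by auto
    then show ?thesis by auto
  qed
  then have "n * (int (card S) * (7 - int (card S))) \<le> n * 12" using n by (intro mult_left_mono) auto
  then have neg: "- 2 * (\<Sum>i\<in>S. u i) \<le> 12 * n" using shift[OF S(1), of 1] by simp
  \<comment> \<open>Deviations from the mean sum to 0, so the sum of their absolute values is twice
    the negative part.\<close>
  have "(\<Sum>i<7. u i) = 0" by (simp add: u_def sum_subtractf flip: sum_distrib_left)
  moreover have "(\<Sum>i<7. \<bar>u i\<bar>) = (\<Sum>i<7. u i + (if i \<in> S then - 2 * u i else 0))"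
    by (intro sum.cong) (auto simp: S_def)
  moreover have "(\<Sum>i<7. if i \<in> S then - 2 * u i else 0) = - 2 * (\<Sum>i\<in>S. u i)"
    using S by (simp add: sum.inter_restrict[symmetric] Int_absorb1 sum_distrib_left flip: sum_negf)
  ultimately have abs: "(\<Sum>i<7. \<bar>u i\<bar>) \<le> 12 * n" using neg by (simp add: sum.distrib)
  \<comment> \<open>The sum of squares is at most the maximum times the sum of absolute values,
    hence at most \<open>36 * n ^ 2\<close>, and \<open>36 / 7 < 6\<close>.\<close>
  have "7 * energy c = (\<Sum>i<7. \<bar>u i\<bar> * \<bar>u i\<bar>)"
    by (simp add: energy_centered u_def power2_eq_square)
  also have "\<dots> \<le> (\<Sum>i<7. 3 * n * \<bar>u i\<bar>)"
    using u_le by (intro sum_mono mult_right_mono) auto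
  also have "\<dots> \<le> 3 * n * (12 * n)"
    unfolding sum_distrib_left[symmetric] using abs n by (intro mult_left_mono) auto
  finally have "7 * energy c \<le> 36 * n\<^sup>2" by (simp add: power2_eq_square)
  moreover have "n\<^sup>2 > 0" using n by simp
  ultimately have "energy c < 6 * n\<^sup>2" by linarith
  then show ?thesis using that[of y] by (simp add: c_def[abs_def])
qed

text \<open>Subtract the minimum and let \<open>k\<close> be the size of the support
  \<open>K\<close>. Cauchy-Schwarz on \<open>K\<close> gives \<open>(7 - k) * S2 \<le> 6\<close>,
  and \<open>S2 \<ge> k\<close> by integrality; this leaves \<open>k = 1\<close> or
  \<open>k = 6\<close>, with all values on \<open>K\<close> equal to 1.\<close>

lemma energy_eq_6:
  assumes "energy c = 6"
  obtains j m e where "j < 7" "e = 1 \<or> e = -1" "\<And>i. i < 7 \<Longrightarrow> c i = m + (if i = j then e else 0)"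
proof -
  define m where "m = Min (c ` {..<7})"
  have m_le: "m \<le> c i" if "i < 7" for i using that by (simp add: m_def)
  have "m \<in> c ` {..<7}" unfolding m_def by (rule Min_in) (auto simp: lessThan_empty_iff)
  then obtain i0 where i0: "i0 < 7" "c i0 = m" by auto
  define v where "v i = c i - m" for i
  define K where "K = {i. i < 7 \<and> v i > 0}"
  have K: "K \<subseteq> {..<7} - {i0}" "finite K" using i0 by (auto simp: K_def v_def)
  define k where "k = int (card K)"
  have "card K \<le> 6" using card_mono[OF _ K(1)] i0 by simp
  then have k6: "k \<in> {0,1,2,3,4,5,6}" by (auto simp: k_def)
  define S1 where "S1 = (\<Sum>i\<in>K. v i)"
  define S2 where "S2 = (\<Sum>i\<in>K. (v i)\<^sup>2)"
  have zero: "v i = 0" if "i < 7" "i \<notin> K" for i using that m_le[of i] by (auto simp: K_def v_def)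
  have "energy v = energy c"
    using energy_shift[of "{..<7}" c "- m"] energy_def[of v] energy_def[of "\<lambda>i. c i + (if i \<in> {..<7} then - m else 0)"]
    by (simp add: v_def sum_subtractf flip: sum_distrib_left)
  moreover have "(\<Sum>i<7. v i) = S1" "(\<Sum>i<7. (v i)\<^sup>2) = S2"
    unfolding S1_def S2_def using zero K by (auto intro!: sum.mono_neutral_right)
  ultimately have E: "7 * S2 - S1\<^sup>2 = 6" using assms by (simp add: energy_def)
  \<comment> \<open>This is Cauchy-Schwarz in the form \<open>S1 ^ 2 \<le> k * S2\<close>.\<close>
  have "0 \<le> (\<Sum>i\<in>K. (k * v i - S1)\<^sup>2)" by (intro sum_nonneg) simp
  also have "\<dots> = (\<Sum>i\<in>K. k\<^sup>2 * (v i)\<^sup>2 - 2 * k * S1 * v i + S1\<^sup>2)"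
    by (intro sum.cong) (simp_all add: power2_eq_square algebra_simps)
  also have "\<dots> = k\<^sup>2 * S2 - 2 * k * S1 * S1 + k * S1\<^sup>2"
    by (simp add: sum.distrib sum_subtractf S2_def k_def) (simp add: S1_def flip: sum_distrib_left)
  finally have "0 \<le> k * (k * S2 - S1\<^sup>2)" by (simp add: power2_eq_square algebra_simps)
  moreover have "k \<noteq> 0"
  proof
    assume "k = 0"
    then have "S1 = 0" "S2 = 0" using K(2) by (simp_all add: k_def S1_def S2_def)
    then show False using E by simp
  qed
  ultimately have "S1\<^sup>2 \<le> k * S2" using k6 by (auto simp: zero_le_mult_iff)
  then have low: "(7 - k) * S2 \<le> 6" using E by (simp add: algebra_simps)
  have sq1: "1 \<le> (v i)\<^sup>2" if "i \<in> K" for i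
    using that zero_less_power[of "v i" 2] by (simp add: K_def)
  then have "(\<Sum>i\<in>K. 1) \<le> S2" unfolding S2_def by (intro sum_mono) auto
  then have S2k: "k \<le> S2" by (simp add: k_def)
  then have "(7 - k) * k \<le> 6" using low k6 mult_left_mono[OF S2k, of "7 - k"] by auto
  then have k16: "k = 1 \<or> k = 6" using k6 \<open>k \<noteq> 0\<close> by auto
  then have "S2 = k" using low S2k by auto
  then have "(\<Sum>i\<in>K. (v i)\<^sup>2 - 1) = 0" by (simp add: sum_subtractf S2_def k_def)
  moreover have "(\<Sum>i\<in>K. (v i)\<^sup>2 - 1) = 0 \<longleftrightarrow> (\<forall>i\<in>K. (v i)\<^sup>2 - 1 = 0)"
    using K(2) by (intro sum_nonneg_eq_0_iff) (simp_all only: diff_ge_0_iff_ge sq1)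
  ultimately have "\<forall>i\<in>K. (v i)\<^sup>2 - 1 = 0" by blast
  then have one: "v i = 1" if "i \<in> K" for i
    using that by (auto simp: K_def power2_eq_1_iff)
  from k16 show ?thesis
  proof
    assume "k = 1"
    then obtain j where "K = {j}" by (auto simp: k_def card_1_singleton_iff)
    then show ?thesis
      using one zero K(1) by (intro that[of j 1 m]) (auto simp: v_def)
  next
    assume "k = 6"
    then have "K = {..<7} - {i0}" using i0 by (intro card_subset_eq K) (simp_all add: k_def)
    then show ?thesis
      \<comment> \<open>Six coordinates one above the minimum are read as a single coordinate one
        below \<open>m + 1\<close>.\<close>
      using one zero i0 by (intro that[of i0 "-1" "m + 1"]) (auto simp: v_def algebra_simps)
  qed
qed

lemma am_gm3:
  fixes a b c :: real
  assumes "a \<ge> 0" "b \<ge> 0" "c \<ge> 0"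
  shows "27 * (a * b * c) \<le> (a + b + c) ^ 3"
proof -
  \<comment> \<open>The first summand on the right is
    \<open>a ^ 3 + b ^ 3 + c ^ 3 - 3 * a * b * c\<close>.\<close>
  have "(a + b + c) ^ 3 - 27 * (a * b * c) = 
     (a + b + c) / 2 * ((a - b)\<^sup>2 + (b - c)\<^sup>2 + (c - a)\<^sup>2) + 3 * (a * (b - c)\<^sup>2 + b * (c - a)\<^sup>2 + c * (a - b)\<^sup>2)"
    by (simp add: power2_eq_square power3_eq_cube field_simps)
  also have "\<dots> \<ge> 0" using assms by (intro add_nonneg_nonneg mult_nonneg_nonneg) auto
  finally show ?thesis by simp
qed

section \<open>Parseval's identity, division with remainder, and units\<close>

context root7
begin

text \<open>Over all seven roots of unity Fourier inversion gives
  \<open>7 * (\<Sum>i<7. (c i) ^ 2)\<close>; the root 1 accounts for the subtracted square of the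
  coordinate sum.\<close>

lemma parseval:
  assumes c: "\<And>x. x ^ 7 = 1 \<Longrightarrow> ev p x = (\<Sum>i<7. of_int (c i) * x ^ i)"
  shows "(\<Sum>a=1..6. (norm (ev p (w ^ a)))\<^sup>2) = of_int (energy c)"
proof -
  have cnj_pow: "cnj ((w ^ b) ^ j) = w ^ (b * (7 - j))" if "j < 7" for b j
  proof -
    have "b * j * 6 + b * j = 7 * (b * j)" "b * (7 - j) + b * j = 7 * b"
      using that by (simp_all flip: distrib_left)
    then have "w ^ (b * j * 6 + b * j) = 1" "w ^ (b * (7 - j) + b * j) = 1"
      by (simp_all only: pow_eq_1_iff dvd_triv_left)
    then have "w ^ (b * j * 6) * w ^ (b * j) = w ^ (b * (7 - j)) * w ^ (b * j)"
      by (simp only: power_add)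
    moreover have "w \<noteq> 0" using norm_w by auto
    ultimately have "w ^ (b * j * 6) = w ^ (b * (7 - j))" by simp
    then show ?thesis by (simp add: cnj_w mult.commute mult.left_commute flip: power_mult)
  qed
  have "complex_of_real (\<Sum>b<7. (norm (ev p (w ^ b)))\<^sup>2) = (\<Sum>b<7. cnj (ev p (w ^ b)) * ev p (w ^ b))"
    unfolding of_real_sum
    by (intro sum.cong refl) (simp add: complex_norm_square mult.commute del: of_real_power)
  also have "\<dots> = (\<Sum>b<7. \<Sum>j<7. of_int (c j) * (w ^ (b * (7 - j)) * ev p (w ^ b)))"
  proof (intro sum.cong refl)
    fix b :: nat
    have "cnj (ev p (w ^ b)) = (\<Sum>j<7. of_int (c j) * w ^ (b * (7 - j)))"
      unfolding c[OF pow_pow_7] cnj_sum by (intro sum.cong refl) (simp add: cnj_pow del: complex_cnj_power)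
    then show "cnj (ev p (w ^ b)) * ev p (w ^ b) =
        (\<Sum>j<7. of_int (c j) * (w ^ (b * (7 - j)) * ev p (w ^ b)))"
      by (simp only: sum_distrib_right mult.assoc)
  qed
  also have "\<dots> = (\<Sum>j<7. of_int (c j) * (\<Sum>b<7. w ^ (b * (7 - j)) * ev p (w ^ b)))"
    by (subst sum.swap) (simp add: sum_distrib_left)
  also have "\<dots> = (\<Sum>j<7. of_int (c j) * (7 * of_int (c j)))"
    using fourier_inversion[of _ c] by (intro sum.cong refl) (simp add: c[OF pow_pow_7])
  also have "\<dots> = complex_of_real (of_int (7 * (\<Sum>i<7. (c i)\<^sup>2)))"
    by (simp add: sum_distrib_left power2_eq_square mult_ac)
  finally have "(\<Sum>b<7. (norm (ev p (w ^ b)))\<^sup>2) = of_int (7 * (\<Sum>i<7. (c i)\<^sup>2))"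
    by (simp only: of_real_eq_iff)
  moreover have "(\<Sum>b<7. (norm (ev p (w ^ b)))\<^sup>2) = (norm (ev p 1))\<^sup>2 + (\<Sum>a=1..6. (norm (ev p (w ^ a)))\<^sup>2)"
    by (simp add: eval_nat_numeral)
  moreover have "ev p 1 = complex_of_real (of_int (\<Sum>i<7. c i))"
    using c[of 1] by simp
  then have "(norm (ev p 1))\<^sup>2 = of_int ((\<Sum>i<7. c i)\<^sup>2)"
    by (simp only: norm_of_real power2_abs of_int_power)
  ultimately show ?thesis by (simp add: energy_def)
qed

text \<open>The conjugates pair up, so half the energy is \<open>A + B + C\<close> and the norm is
  \<open>A * B * C\<close>. The constant 216 is 27 from the mean inequality times
  \<open>2 ^ 3\<close>.\<close>

lemma nrm_le_energy:
  assumes c: "\<And>x. x ^ 7 = 1 \<Longrightarrow> ev p x = (\<Sum>i<7. of_int (c i) * x ^ i)"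
  shows "216 * nrm p \<le> energy c ^ 3"
proof -
  define A B C where "A = (norm (ev p w))\<^sup>2" "B = (norm (ev p (w ^ 2)))\<^sup>2" "C = (norm (ev p (w ^ 3)))\<^sup>2"
  note ABC = this
  have e: "norm (ev p (w ^ 4)) = norm (ev p (w ^ 3))" "norm (ev p (w ^ 5)) = norm (ev p (w ^ 2))"
    "norm (ev p (w ^ 6)) = norm (ev p w)"
    by (simp_all add: ev_high_powers)
  have "{1..6::nat} = {1,2,3,4,5,6}" by auto
  then have "2 * (A + B + C) = of_int (energy c)"
    using parseval[OF c] e by (simp add: ABC)
  then have "A + B + C = of_int (energy c) / 2" by (simp add: field_simps)
  moreover have "27 * (A * B * C) \<le> (A + B + C) ^ 3" by (rule am_gm3) (simp_all add: ABC)
  moreover have "real_of_int (nrm p) = A * B * C" by (simp add: nrm_norm ABC power_mult_distrib)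
  ultimately have "27 * real_of_int (nrm p) \<le> (of_int (energy c) / 2) ^ 3" by metis
  then have "real_of_int (216 * nrm p) \<le> of_int (energy c ^ 3)" by (simp add: power_divide)
  then show ?thesis by (simp only: of_int_le_iff)
qed

definition conj_prod :: "int poly \<Rightarrow> int poly" where
  "conj_prod g = (\<Prod>a=2..6. subst_pow a g)"

lemma ev_conj_prod: "ev g w * ev (conj_prod g) w = of_int (nrm g)"
proof -
  have "{1..6::nat} = insert 1 {2..6}" by auto
  then show ?thesis by (simp add: of_int_nrm norm_prod_def conj_prod_def)
qed

lemma nrm_const: "nrm [:n:] = n ^ 6"
proof -
  have "complex_of_int (nrm [:n:]) = of_int (n ^ 6)" by (simp add: of_int_nrm norm_prod_def)
  then show ?thesis by (simp only: of_int_eq_iff)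
qed

lemma nrm_pos_iff: "nrm g > 0 \<longleftrightarrow> ev g w \<noteq> 0"
  using nrm_nonneg[of g] nrm_eq_0_iff[of g] by linarith

text \<open>With \<open>n = nrm g\<close> and \<open>g * g' = n\<close>, rounding the coordinates of
  \<open>p * g'\<close> modulo \<open>n\<close> leaves energy below \<open>6 * n ^ 2\<close>, hence
  norm below \<open>n ^ 6\<close>. Cancelling \<open>nrm g' = n ^ 5\<close> leaves a remainder of
  norm below \<open>n\<close>.\<close>

lemma euclidean_division:
  assumes "ev g w \<noteq> 0"
  obtains y where "nrm (p - y * g) < nrm g"
proof -
  define n where "n = nrm g"
  have n: "n > 0" using assms nrm_pos_iff by (simp add: n_def)
  define g' where "g' = conj_prod g"
  have g': "ev g w * ev g' w = of_int n" using ev_conj_prod by (simp add: g'_def n_def)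
  have "nrm (g * g') = nrm [:n:]" using g' by (intro nrm_cong_ev) simp
  then have "n * nrm g' = n * n ^ 5" by (simp add: nrm_mult nrm_const flip: n_def power_Suc)
  then have ng': "nrm g' = n ^ 5" using n by simp
  obtain x where x: "\<And>z. z ^ 7 = 1 \<Longrightarrow> ev (p * g') z = (\<Sum>i<7. of_int (x i) * z ^ i)"
    using coords_exist[of "p * g'"] by metis
  obtain y where y: "energy (\<lambda>i. x i - n * y i) < 6 * n\<^sup>2" using energy_covering[OF n] by blast
  define Y where "Y = (\<Sum>i<7. Polynomial.monom (y i) i)"
  have "ev (p * g' - Polynomial.smult n Y) z = (\<Sum>i<7. of_int (x i - n * y i) * z ^ i)" if "z ^ 7 = 1" for z
    unfolding ev_diff x[OF that] Y_def by (simp add: sum_distrib_left sum_subtractf algebra_simps)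
  then have "216 * nrm (p * g' - Polynomial.smult n Y) \<le> energy (\<lambda>i. x i - n * y i) ^ 3"
    by (rule nrm_le_energy)
  also have "\<dots> < (6 * n\<^sup>2) ^ 3" by (intro power_strict_mono y energy_nonneg) simp
  also have "\<dots> = 216 * (n * n ^ 5)" by (simp add: power_mult_distrib flip: power_mult power_Suc)
  finally have "nrm (p * g' - Polynomial.smult n Y) < n * n ^ 5" by simp
  moreover have "nrm (p * g' - Polynomial.smult n Y) = nrm ((p - Y * g) * g')"
    by (rule nrm_cong_ev) (simp add: g'[symmetric] left_diff_distrib right_diff_distrib mult_ac)
  ultimately have "nrm (p - Y * g) * n ^ 5 < n * n ^ 5" by (simp add: nrm_mult ng')
  then have "nrm (p - Y * g) < n" using n by simp
  then show ?thesis using that by (simp add: n_def)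
qed

text \<open>An element of least positive norm generates, since remainders of division by it have
  smaller norm. Stating this for sets of polynomials lets it yield greatest common divisors as well
  as generators of ideals.\<close>

lemma principal:
  assumes "0 \<in> I" and diff: "\<And>p q. p \<in> I \<Longrightarrow> q \<in> I \<Longrightarrow> p - q \<in> I"
    and mult: "\<And>r p. p \<in> I \<Longrightarrow> r * p \<in> I"
  obtains g where "g \<in> I" "\<And>p. p \<in> I \<Longrightarrow> \<exists>y. ev p w = ev (y * g) w"
proof (cases "\<forall>p\<in>I. ev p w = 0")
  case True
  then show ?thesis using that[of 0] assms(1) by auto
next
  case False
  then obtain p0 where "p0 \<in> I \<and> ev p0 w \<noteq> 0" by blast
  from ex_has_least_nat[of "\<lambda>p. p \<in> I \<and> ev p w \<noteq> 0", OF this, of "\<lambda>p. nat (nrm p)"]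
  obtain g where g: "g \<in> I" "ev g w \<noteq> 0"
    and min: "\<And>p. p \<in> I \<Longrightarrow> ev p w \<noteq> 0 \<Longrightarrow> nat (nrm g) \<le> nat (nrm p)" by auto
  have "\<exists>y. ev p w = ev (y * g) w" if "p \<in> I" for p
  proof -
    obtain y where y: "nrm (p - y * g) < nrm g" using euclidean_division[OF g(2)] by blast
    have "p - y * g \<in> I" using that g(1) diff mult by blast
    then have "ev (p - y * g) w = 0" using min[of "p - y * g"] y nrm_nonneg[of "p - y * g"] by force
    then show ?thesis by auto
  qed
  then show ?thesis using that g(1) by blast
qed

lemma nrm_1_iff: "nrm p = 1 \<longleftrightarrow> (\<exists>q. ev (p * q) w = 1)"
proof
  assume "nrm p = 1"
  then show "\<exists>q. ev (p * q) w = 1" using ev_conj_prod[of p] by (intro exI[of _ "conj_prod p"]) simp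
next
  assume "\<exists>q. ev (p * q) w = 1"
  then obtain q where "ev (p * q) w = 1" by blast
  then have "nrm (p * q) = nrm [:1:]" by (intro nrm_cong_ev) simp
  then have "nrm p * nrm q = 1" by (simp add: nrm_mult nrm_const)
  then show "nrm p = 1" using nrm_nonneg[of p] zmult_eq_1_iff by auto
qed

text \<open>The quotient of a unit by its complex conjugate has absolute value 1 at every embedding, hence
  energy 6, so it is a root of unity up to sign.\<close>

lemma unit_cumul3:
  assumes "nrm p = 1"
  shows "7 dvd cumul3 p"
proof -
  obtain q where q: "ev (p * q) w = 1" using assms nrm_1_iff by blast
  \<comment> \<open>As \<open>q\<close> represents the inverse of \<open>p\<close>, this represents
    \<open>p\<close> divided by its complex conjugate.\<close>
  define v where "v = p * subst_pow 6 q"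
  have abs1: "norm (ev v (w ^ a)) = 1" if "a \<in> {1..6}" for a
  proof -
    have "\<not> 7 dvd a" using that by auto
    then have "ev (p * q) (w ^ a) = 1" using ev_eq_conj[of "p * q" 1 a] q by simp
    moreover have "ev q ((w ^ a) ^ 6) = cnj (ev q (w ^ a))"
      by (simp add: cnj_ev_pow mult.commute flip: power_mult)
    then have "norm (ev v (w ^ a)) = norm (ev (p * q) (w ^ a))"
      by (simp add: v_def norm_mult)
    ultimately show ?thesis by simp
  qed
  obtain c where c: "\<And>z. z ^ 7 = 1 \<Longrightarrow> ev v z = (\<Sum>i<7. of_int (c i) * z ^ i)"
    using coords_exist[of v] by metis
  have "real_of_int (energy c) = 6" using parseval[OF c] abs1 by simp
  then have "energy c = 6" by linarith
  then obtain j m e where j: "j < 7" "e = 1 \<or> e = -1"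
    "\<And>i. i < 7 \<Longrightarrow> c i = m + (if i = j then e else 0)" by (rule energy_eq_6) blast
  have "ev v w = (\<Sum>i<7. of_int m * w ^ i + (if i = j then of_int e * w ^ i else 0))"
    unfolding c[OF pow7] by (intro sum.cong) (auto simp: j(3) algebra_simps)
  \<comment> \<open>The constant part \<open>m\<close> multiplies the sum of all powers of
    \<open>w\<close>, which is 0.\<close>
  also have "\<dots> = of_int m * (\<Sum>i<7. (w ^ 1) ^ i) + of_int e * w ^ j"
    using j(1) by (simp add: sum.distrib sum_distrib_left)
  also have "\<dots> = ev (Polynomial.monom e j) w"
    by (subst sum_powers) simp
  finally have "[cumul3 v = cumul3 (Polynomial.monom e j)] (mod 7)" by (rule cumul3_cong)
  moreover have "cumul3 (Polynomial.monom e j) = 0"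
    using j(2) by (auto simp: cumul3_def moment_monom power2_eq_square power3_eq_cube)
  ultimately have v: "7 dvd cumul3 v" by (simp add: cong_0_iff)
  have "[cumul3 (p * q) = cumul3 1] (mod 7)" using q by (intro cumul3_cong) simp
  moreover have "cumul3 1 = 0" by (simp add: cumul3_def one_pCons)
  ultimately have pq: "7 dvd cumul3 (p * q)" by (simp add: cong_0_iff)
  \<comment> \<open>Since \<open>6 ^ 3 = 216\<close> is -1 modulo 7, the contributions of
    \<open>q\<close> cancel up to \<open>217 = 7 * 31\<close>, while those of \<open>p\<close>
    double.\<close>
  have "cumul3 v + cumul3 (p * q) =
      2 * (moment 0 q ^ 3 * cumul3 p) + 7 * (31 * moment 0 p ^ 3 * cumul3 q)"
    by (simp add: v_def cumul3_mult cumul3_subst_pow moment_subst_pow)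
  then have "7 dvd 2 * (moment 0 q ^ 3 * cumul3 p)"
    using dvd_add[OF v pq] by (simp only: dvd_add_left_iff dvd_triv_left)
  then have "7 dvd moment 0 q ^ 3 * cumul3 p"
    by (simp add: prime_dvd_mult_iff[of "7::int"])
  moreover have "\<not> 7 dvd moment 0 q"
  proof
    assume "7 dvd moment 0 q"
    moreover have "[moment 0 (p * q) = moment 0 1] (mod 7)" using q by (intro moment_cong) simp_all
    then have "[moment 0 p * moment 0 q = 1] (mod 7)" by (simp add: moment_mult one_pCons)
    ultimately have "[(0::int) = 1] (mod 7)" by (metis cong_0_iff cong_sym cong_trans dvd_mult)
    then show False by (simp add: cong_def)
  qed
  ultimately show ?thesis
    by (simp add: prime_dvd_mult_iff[of "7::int"] prime_dvd_power_iff)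
qed

end

section \<open>The logarithm modulo 7\<close>

text \<open>The integer \<open>j ^ 5\<close> represents the inverse of \<open>j\<close> modulo 7.\<close>

definition log_poly :: "int poly \<Rightarrow> int poly" where
  "log_poly p = (\<Sum>j=1..5. [:(-1) ^ (j + 1):] * (p - 1) ^ j * [:int j ^ 5:])"

lemma moment_1_right: "moment 0 1 = 1" "k > 0 \<Longrightarrow> moment k 1 = 0"
  by (simp_all add: one_pCons)

lemma moment_0_power: "moment 0 (p ^ n) = moment 0 p ^ n"
  by (induction n) (simp_all add: moment_mult moment_1_right)

lemma moment_const_mult: "moment k ([:c:] * p) = c * moment k p" "moment k (p * [:c:]) = c * moment k p"
  by (simp_all add: mult.commute)

lemma log_poly_expand: "log_poly p = (p - 1) + Polynomial.smult (-32) ((p - 1) ^ 2)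
    + Polynomial.smult 243 ((p - 1) ^ 3) + Polynomial.smult (-1024) ((p - 1) ^ 4)
    + Polynomial.smult 3125 ((p - 1) ^ 5)"
proof -
  have "{1..5::nat} = {1,2,3,4,5}" by auto
  then show ?thesis by (simp add: log_poly_def)
qed

lemma moment_0_log_poly:
  assumes "[moment 0 p = 1] (mod 7)"
  shows "[moment 0 (log_poly p) = 0] (mod 7)"
proof -
  have "7 dvd moment 0 (p - 1)" using assms by (simp add: moment_1_right cong_iff_dvd_diff)
  then show ?thesis unfolding log_poly_expand cong_0_iff moment_add moment_smult moment_0_power
    by (intro dvd_add dvd_mult) (simp_all add: prime_dvd_power_iff)
qed

text \<open>The constant term of \<open>X = p - 1\<close> vanishes modulo 7, so \<open>X ^ 4\<close>
  and \<open>X ^ 5\<close> have third moment 0. The terms \<open>X - X ^ 2 / 2 + X ^ 3 / 3\<close>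
  produce the third cumulant.\<close>

lemma moment_3_log_poly:
  assumes "[moment 0 p = 1] (mod 7)"
  shows "[moment 3 (log_poly p) = cumul3 p] (mod 7)"
proof -
  define X where "X = p - 1"
  define a b c where "a = moment 1 X" "b = moment 2 X" "c = moment 3 X"
  note abc = this
  have X0: "[moment 0 X = 0] (mod 7)" using assms by (simp add: X_def moment_1_right cong_iff_dvd_diff)
  \<comment> \<open>The Leibniz rule for multiplication by \<open>X\<close>, with every term
    containing \<open>moment 0 X\<close> dropped.\<close>
  have step: "[moment 0 (X * Y) = 0] (mod 7) \<and> [moment 1 (X * Y) = a * A0] (mod 7) \<and>
      [moment 2 (X * Y) = b * A0 + 2 * a * A1] (mod 7) \<and>
      [moment 3 (X * Y) = c * A0 + 3 * b * A1 + 3 * a * A2] (mod 7)"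
    if "[moment 0 Y = A0] (mod 7) \<and> [moment 1 Y = A1] (mod 7) \<and> [moment 2 Y = A2] (mod 7) \<and> [moment 3 Y = A3] (mod 7)"
    for Y A0 A1 A2 A3
  proof -
    have 0: "[moment 0 X * moment 0 Y = 0 * A0] (mod 7)"
      using X0 that by (intro cong_mult) auto
    have 1: "[moment 1 X * moment 0 Y + moment 0 X * moment 1 Y = a * A0 + 0 * A1] (mod 7)"
      unfolding abc using X0 that by (intro cong_add cong_mult) auto
    have 2: "[moment 2 X * moment 0 Y + 2 * moment 1 X * moment 1 Y + moment 0 X * moment 2 Y
        = b * A0 + 2 * a * A1 + 0 * A2] (mod 7)"
      unfolding abc using X0 that by (intro cong_add cong_mult) auto
    have 3: "[moment 3 X * moment 0 Y + 3 * moment 2 X * moment 1 Y + 3 * moment 1 X * moment 2 Y + moment 0 X * moment 3 Y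
        = c * A0 + 3 * b * A1 + 3 * a * A2 + 0 * A3] (mod 7)"
      unfolding abc using X0 that by (intro cong_add cong_mult) auto
    show ?thesis using 0 1 2 3 unfolding moment_mult by simp
  qed
  have p1: "[moment 0 X = 0] (mod 7) \<and> [moment 1 X = a] (mod 7) \<and> [moment 2 X = b] (mod 7) \<and> [moment 3 X = c] (mod 7)"
    using X0 by (simp add: abc)
  note p2 = step[OF p1]
  note p3 = step[OF p2]
  note p4 = step[OF p3]
  note p5 = step[OF p4]
  have pow: "X ^ 2 = X * X" "X ^ 3 = X * (X * X)" "X ^ 4 = X * (X * (X * X))" "X ^ 5 = X * (X * (X * (X * X)))"
    by (simp_all add: eval_nat_numeral)
  have "[moment 3 (log_poly p) = c + (-32) * (c * 0 + 3 * b * a + 3 * a * b)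
      + 243 * (c * 0 + 3 * b * (a * 0) + 3 * a * (b * 0 + 2 * a * a))
      + (-1024) * 0 + 3125 * 0] (mod 7)"
    unfolding log_poly_expand X_def[symmetric] moment_add moment_smult pow
    using p1 p2 p3 p4 p5 by (intro cong_add cong_mult cong_refl) auto
  also have "[c + (-32) * (c * 0 + 3 * b * a + 3 * a * b)
      + 243 * (c * 0 + 3 * b * (a * 0) + 3 * a * (b * 0 + 2 * a * a))
      + (-1024) * 0 + 3125 * 0 = 1\<^sup>2 * c - 3 * 1 * a * b + 2 * a ^ 3] (mod 7)"
  proof -
    have eq: "c + (-32) * (c * 0 + 3 * b * a + 3 * a * b)
      + 243 * (c * 0 + 3 * b * (a * 0) + 3 * a * (b * 0 + 2 * a * a)) + (-1024) * 0 + 3125 * 0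
      - (1\<^sup>2 * c - 3 * 1 * a * b + 2 * a ^ 3) = 7 * (208 * a ^ 3 - 27 * a * b)"
      by (simp add: power3_eq_cube algebra_simps)
    show ?thesis unfolding cong_iff_dvd_diff eq by simp
  qed
  also have "[1\<^sup>2 * c - 3 * 1 * a * b + 2 * a ^ 3 = cumul3 p] (mod 7)"
  proof -
    have "moment 1 p = a" "moment 2 p = b" "moment 3 p = c"
      by (simp_all add: abc X_def moment_1_right)
    then show ?thesis unfolding cumul3_def using assms
      by (intro cong_add cong_diff cong_mult cong_pow cong_refl) (simp_all add: cong_sym_eq)
  qed
  finally show ?thesis .
qed

section \<open>Powers of \<open>\<Lambda>\<close> in moment coordinates\<close>

definition Lambda_poly :: "int poly" where
  "Lambda_poly = log_poly [:0, 1:]"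

text \<open>In the coordinates for the basis \<open>\<Lambda> ^ k / k!\<close>,
  \<open>\<Lambda>\<close> itself is a basis vector; this is checked on its explicit integer
  representative.\<close>

lemma moment_Lambda_poly:
  assumes "k \<le> 5"
  shows "[moment k Lambda_poly = (if k = 1 then 1 else 0)] (mod 7)"
proof -
  have L: "Lambda_poly = [:-4425, 20515, -38155, 35589, -16649, 3125:]"
    by (simp add: Lambda_poly_def log_poly_expand eval_nat_numeral one_pCons)
  have "moment 0 Lambda_poly = 0" "moment 1 Lambda_poly = 1" "moment 2 Lambda_poly = -63"
    "moment 3 Lambda_poly = 1267" "moment 4 Lambda_poly = -16275" "moment 5 Lambda_poly = 164731"
    unfolding L moment_numeral by (simp_all add: moment_def euler_def pderiv_pCons)
  moreover have "k \<in> {0,1,2,3,4,5}" using assms by auto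
  ultimately show ?thesis by (auto simp: cong_def)
qed

text \<open>Multiplication by \<open>\<Lambda>\<close> sends
  \<open>\<Lambda> ^ (k - 1) / (k - 1)!\<close> to \<open>k\<close> times the next basis vector. For
  \<open>k = 0\<close> the truncated \<open>k - 1\<close> does no harm, as the factor
  \<open>int k\<close> is 0.\<close>

lemma moment_Lambda_mult:
  assumes "k \<le> 5"
  shows "[moment k (Lambda_poly * q) = int k * moment (k - 1) q] (mod 7)"
proof -
  note L = moment_Lambda_poly[of 0, simplified] moment_Lambda_poly[of 1, unfolded if_P[OF refl], OF one_le_numeral]
    moment_Lambda_poly[of 2, simplified] moment_Lambda_poly[of 3, simplified]
    moment_Lambda_poly[of 4, simplified] moment_Lambda_poly[of 5, simplified]
  let ?m = "\<lambda>k. moment k q"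
  have "[moment 0 (Lambda_poly * q) = 0 * ?m 0] (mod 7)"
    unfolding moment_mult by (intro cong_mult cong_refl L)
  moreover have "[moment 1 (Lambda_poly * q) = 1 * ?m 0 + 0 * ?m 1] (mod 7)"
    unfolding moment_mult by (intro cong_add cong_mult cong_refl L)
  moreover have "[moment 2 (Lambda_poly * q) = 0 * ?m 0 + 2 * 1 * ?m 1 + 0 * ?m 2] (mod 7)"
    unfolding moment_mult by (intro cong_add cong_mult cong_refl L)
  moreover have "[moment 3 (Lambda_poly * q) = 0 * ?m 0 + 3 * 0 * ?m 1 + 3 * 1 * ?m 2 + 0 * ?m 3] (mod 7)"
    unfolding moment_mult by (intro cong_add cong_mult cong_refl L)
  moreover have "[moment 4 (Lambda_poly * q) = 0 * ?m 0 + 4 * 0 * ?m 1 + 6 * 0 * ?m 2 + 4 * 1 * ?m 3 + 0 * ?m 4] (mod 7)"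
    unfolding moment_mult by (intro cong_add cong_mult cong_refl L)
  moreover have "[moment 5 (Lambda_poly * q) = 0 * ?m 0 + 5 * 0 * ?m 1 + 10 * 0 * ?m 2 + 10 * 0 * ?m 3
      + 5 * 1 * ?m 4 + 0 * ?m 5] (mod 7)"
    unfolding moment_mult by (intro cong_add cong_mult cong_refl L)
  moreover have "k \<in> {0,1,2,3,4,5}" using assms by auto
  ultimately show ?thesis by auto
qed

lemma moment_Lambda_power:
  assumes "k \<le> 5"
  shows "[moment k (Lambda_poly ^ j) = (if k = j then fact k else 0)] (mod 7)"
  using assms
proof (induction j arbitrary: k)
  case 0
  then show ?case by (cases "k = 0") (simp_all add: moment_1_right)
next
  case (Suc j)
  have "[moment k (Lambda_poly ^ Suc j) = int k * moment (k - 1) (Lambda_poly ^ j)] (mod 7)"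
    using moment_Lambda_mult[OF Suc.prems] by simp
  also have "[int k * moment (k - 1) (Lambda_poly ^ j) = int k * (if k - 1 = j then fact (k - 1) else 0)] (mod 7)"
    using Suc.prems by (intro cong_mult cong_refl Suc.IH) simp
  also have "int k * (if k - 1 = j then fact (k - 1) else 0) = (if k = Suc j then fact k else 0)"
    by (cases k) auto
  finally show ?case .
qed

definition Lambda_comb :: "(nat \<Rightarrow> int) \<Rightarrow> int poly" where
  "Lambda_comb c = (\<Sum>j=1..5. [:c j:] * Lambda_poly ^ j)"

lemma moment_Lambda_comb:
  assumes "k \<le> 5"
  shows "[moment k (Lambda_comb c) = (if k = 0 then 0 else c k * fact k)] (mod 7)"
proof -
  have "[moment k (Lambda_comb c) = (\<Sum>j=1..5. c j * (if k = j then fact k else 0))] (mod 7)"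
    unfolding Lambda_comb_def moment_sum moment_const_mult
    by (intro cong_sum cong_mult cong_refl moment_Lambda_power assms)
  also have "(\<Sum>j=1..5. c j * (if k = j then fact k else 0)) = (\<Sum>j=1..5. if k = j then c j * fact k else 0)"
    by (intro sum.cong) auto
  also have "\<dots> = (if k = 0 then 0 else c k * fact k)"
    using assms by (simp add: sum.delta')
  finally show ?thesis .
qed

lemma int_fermat_7:
  assumes "\<not> 7 dvd (a :: int)"
  shows "[a * a ^ 5 = 1] (mod 7)"
proof -
  have "a mod 7 \<noteq> 0" "0 \<le> a mod 7" "a mod 7 < 7" using assms by (auto simp: dvd_eq_mod_eq_0)
  then have "a mod 7 \<in> {1,2,3,4,5,6}" by auto
  then have "(a mod 7) ^ 6 mod 7 = 1" by auto
  then show ?thesis by (simp add: cong_def power_mod flip: power_Suc)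
qed

lemma int_fermat_7_solve:
  assumes "\<not> 7 dvd (f :: int)"
  shows "[m = c * f] (mod 7) \<longleftrightarrow> [c = m * f ^ 5] (mod 7)"
proof
  assume "[m = c * f] (mod 7)"
  then have "[m * f ^ 5 = c * f * f ^ 5] (mod 7)" by (intro cong_mult cong_refl)
  also have "[c * f * f ^ 5 = c * 1] (mod 7)"
    unfolding mult.assoc by (intro cong_mult cong_refl int_fermat_7 assms)
  finally show "[c = m * f ^ 5] (mod 7)" by (simp add: cong_sym_eq)
next
  assume "[c = m * f ^ 5] (mod 7)"
  then have "[c * f = m * f ^ 5 * f] (mod 7)" by (intro cong_mult cong_refl)
  also have "m * f ^ 5 * f = m * (f * f ^ 5)" by (simp add: mult_ac)
  also have "[m * (f * f ^ 5) = m * 1] (mod 7)"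
    by (intro cong_mult cong_refl int_fermat_7 assms)
  finally show "[m = c * f] (mod 7)" by (simp add: cong_sym_eq)
qed

lemma not_7_dvd_fact: "k \<le> 5 \<Longrightarrow> \<not> 7 dvd (fact k :: int)"
proof -
  assume "k \<le> 5"
  then have "k \<in> {0,1,2,3,4,5}" by auto
  then show ?thesis by (auto simp: fact_numeral)
qed

section \<open>The ring \<open>A7\<close> and its logarithm in terms of polynomials\<close>

context root7
begin

abbreviation R where "R \<equiv> Zomega w"

lemma carrier_R: "carrier R = range (\<lambda>p. ev p w)"
  by (auto simp: Zomega_def ev_def)

lemma ev_in_R [simp, intro]: "ev p w \<in> carrier R"
  by (simp add: carrier_R)

lemma R_simps [simp]: "mult R = (*)" "add R = (+)" "one R = 1" "zero R = 0"
  by (simp_all add: Zomega_def)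

sublocale R: cring R
proof (intro cringI abelian_groupI comm_monoidI)
  show "\<exists>y\<in>carrier R. y \<oplus>\<^bsub>R\<^esub> x = \<zero>\<^bsub>R\<^esub>" if x: "x \<in> carrier R" for x
  proof -
    obtain p where "x = ev p w" using x unfolding carrier_R by blast
    then show ?thesis using ev_in_R[of "- p"] by (intro bexI[of _ "- x"]) simp_all
  qed
  show "\<zero>\<^bsub>R\<^esub> \<in> carrier R" "\<one>\<^bsub>R\<^esub> \<in> carrier R"
    using ev_in_R[of 0] ev_in_R[of 1] by simp_all
  show "x \<oplus>\<^bsub>R\<^esub> y \<in> carrier R" "x \<otimes>\<^bsub>R\<^esub> y \<in> carrier R"
    if "x \<in> carrier R" "y \<in> carrier R" for x y
    using that by (auto simp: carrier_R simp flip: ev_add ev_mult)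
qed (simp_all add: algebra_simps)

lemma PIdl_R: "PIdl\<^bsub>R\<^esub> (ev g w) = {ev (q * g) w | q. True}"
  by (auto simp: cgenideal_def carrier_R)

lemma ev_in_PIdl_iff: "ev p w \<in> PIdl\<^bsub>R\<^esub> (ev g w) \<longleftrightarrow> (\<exists>q. ev p w = ev (q * g) w)"
  unfolding PIdl_R by blast

lemma minus_R: "x \<in> carrier R \<Longrightarrow> y \<in> carrier R \<Longrightarrow> x \<ominus>\<^bsub>R\<^esub> y = x - y"
proof -
  assume "x \<in> carrier R" "y \<in> carrier R"
  then obtain q where y: "y = ev q w" by (auto simp: carrier_R)
  have "\<ominus>\<^bsub>R\<^esub> y = - y"
    using R.minus_equality[of "- y" y] ev_in_R[of "- q"] by (simp add: y)
  then show ?thesis by (simp add: a_minus_def)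
qed

lemma ideal_7: "ideal (PIdl\<^bsub>R\<^esub> 7) R"
  using R.cgenideal_ideal[OF ev_in_R[of "[:7:]"]] by simp

sublocale A: ring_hom_cring R "A7 w" "to_A w"
  using ideal.rcos_ring_hom_cring[OF ideal_7 R.is_cring]
  by (simp add: A7_def to_A_def[abs_def])

definition red :: "int poly \<Rightarrow> complex set" where
  "red p = to_A w (ev p w)"

lemma red_closed [simp, intro]: "red p \<in> carrier (A7 w)"
  by (simp add: red_def)

lemma carrier_A7: "carrier (A7 w) = range red"
  by (auto simp: A7_def FactRing_def A_RCOSETS_def' carrier_R red_def to_A_def)

text \<open>The six moments are a faithful coordinate system on \<open>A7\<close>:
  \<open>moment_cong\<close> makes them well defined and \<open>moment_kernel\<close> makes them
  separate classes.\<close>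

lemma red_eq_iff: "red p = red q \<longleftrightarrow> (\<forall>k\<le>5. [moment k p = moment k q] (mod 7))"
proof -
  have "red p = red q \<longleftrightarrow> ev p w \<ominus>\<^bsub>R\<^esub> ev q w \<in> PIdl\<^bsub>R\<^esub> 7"
    unfolding red_def to_A_def
    using R.quotient_eq_iff_same_a_r_cos[OF ideal_7, of "ev p w" "ev q w"] by simp
  also have "\<dots> \<longleftrightarrow> ev (p - q) w \<in> PIdl\<^bsub>R\<^esub> (ev [:7:] w)"
    by (simp add: minus_R)
  also have "\<dots> \<longleftrightarrow> (\<exists>r. ev (p - q) w = ev (Polynomial.smult 7 r) w)"
    unfolding ev_in_PIdl_iff by (simp add: mult.commute)
  also have "\<dots> \<longleftrightarrow> (\<forall>k\<le>5. 7 dvd moment k (p - q))"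
  proof
    assume "\<exists>r. ev (p - q) w = ev (Polynomial.smult 7 r) w"
    then obtain r where "ev (p - q) w = ev (Polynomial.smult 7 r) w" by blast
    then have "[moment k (p - q) = 7 * moment k r] (mod 7)" if "k \<le> 5" for k
      using moment_cong[OF _ that, of "p - q"] by (metis moment_smult)
    then show "\<forall>k\<le>5. 7 dvd moment k (p - q)"
      by (metis cong_0_iff cong_trans dvd_triv_left)
  next
    assume "\<forall>k\<le>5. 7 dvd moment k (p - q)"
    then obtain r s where "p - q = Phi7 * r + Polynomial.smult 7 s"
      by (auto intro: moment_kernel[of "p - q"])
    then have "ev (p - q) w = ev (Phi7 * r + Polynomial.smult 7 s) w" by simp
    then show "\<exists>r. ev (p - q) w = ev (Polynomial.smult 7 r) w"
      by (intro exI[of _ s]) simp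
  qed
  finally show ?thesis by (simp add: cong_iff_dvd_diff)
qed

lemma red_add: "red p \<oplus>\<^bsub>A7 w\<^esub> red q = red (p + q)"
  by (simp add: red_def flip: A.hom_add)

lemma red_mult: "red p \<otimes>\<^bsub>A7 w\<^esub> red q = red (p * q)"
  by (simp add: red_def flip: A.hom_mult)

lemma red_1: "\<one>\<^bsub>A7 w\<^esub> = red 1"
  by (simp add: red_def flip: A.hom_one)

lemma red_pow: "red p [^]\<^bsub>A7 w\<^esub> n = red (p ^ n)" for n :: nat
  by (induction n) (simp_all add: red_1 red_mult mult.commute)

lemma red_0: "\<zero>\<^bsub>A7 w\<^esub> = red 0"
  using A.hom_zero by (simp add: red_def)

lemma red_diff: "red p \<ominus>\<^bsub>A7 w\<^esub> red q = red (p - q)"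
proof -
  have "red (- q) \<oplus>\<^bsub>A7 w\<^esub> red q = \<zero>\<^bsub>A7 w\<^esub>" by (simp add: red_add red_0)
  then have "\<ominus>\<^bsub>A7 w\<^esub> red q = red (- q)"
    using A.S.minus_equality by blast
  then show ?thesis by (simp add: a_minus_def red_add)
qed

lemma red_finsum:
  assumes "finite S"
  shows "(\<Oplus>\<^bsub>A7 w\<^esub>j\<in>S. red (f j)) = red (\<Sum>j\<in>S. f j)"
  using assms
proof (induction S)
  case empty
  show ?case by (simp add: red_0)
next
  case (insert x S)
  then show ?case by (subst A.S.finsum_insert) (auto simp: red_add)
qed

lemma to_A_int: "to_A w (of_int a) = red [:a:]"
  by (simp add: red_def)

lemma inv_red: "red (p * q) = red 1 \<Longrightarrow> inv\<^bsub>A7 w\<^esub> (red p) = red q"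
  by (intro A.S.comm_inv_char) (simp_all add: red_mult red_1)

lemma inv_red_int:
  assumes "\<not> 7 dvd a"
  shows "inv\<^bsub>A7 w\<^esub> (to_A w (of_int a)) = red [:a ^ 5:]"
proof -
  have "red ([:a:] * [:a ^ 5:]) = red 1"
    unfolding red_eq_iff
  proof (intro allI impI)
    fix k
    show "[moment k ([:a:] * [:a ^ 5:]) = moment k 1] (mod 7)"
      using int_fermat_7[OF assms] by (cases "k = 0") (simp_all add: one_pCons mult.commute)
  qed
  then show ?thesis unfolding to_A_int by (rule inv_red)
qed

lemma log_A_red: "log_A w (red p) = red (log_poly p)"
proof -
  have "to_A w ((- 1) ^ (j + 1)) \<otimes>\<^bsub>A7 w\<^esub> ((red p \<ominus>\<^bsub>A7 w\<^esub> \<one>\<^bsub>A7 w\<^esub>) [^]\<^bsub>A7 w\<^esub> j)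
      \<otimes>\<^bsub>A7 w\<^esub> inv\<^bsub>A7 w\<^esub> (to_A w (of_nat j)) =
    red ([:(-1) ^ (j + 1):] * (p - 1) ^ j * [:int j ^ 5:])" if "j \<in> {1..5}" for j
  proof -
    have "\<not> (7::int) dvd int j" using that by (auto dest: zdvd_imp_le)
    then have "inv\<^bsub>A7 w\<^esub> (to_A w (of_nat j)) = red [:int j ^ 5:]"
      using inv_red_int[of "int j"] by simp
    moreover have "to_A w ((- 1) ^ (j + 1)) = red [:(-1) ^ (j + 1):]"
      using to_A_int[of "(-1) ^ (j + 1)"] by simp
    ultimately show ?thesis by (simp only: red_1 red_diff red_pow red_mult)
  qed
  then have "log_A w (red p) =
      (\<Oplus>\<^bsub>A7 w\<^esub>j\<in>{1..5}. red ([:(-1) ^ (j + 1):] * (p - 1) ^ j * [:int j ^ 5:]))"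
    unfolding log_A_def by (intro A.S.finsum_cong') auto
  then show ?thesis by (simp only: red_finsum finite_atLeastAtMost log_poly_def)
qed

lemma Lambda_red: "Lambda w = red Lambda_poly"
proof -
  have "to_A w w = red [:0, 1:]" by (simp add: red_def)
  then show ?thesis by (simp add: Lambda_def Lambda_poly_def log_A_red)
qed

lemma PIdl_A7: "PIdl\<^bsub>A7 w\<^esub> (red g) = {red (q * g) | q. True}"
  by (auto simp: cgenideal_def carrier_A7 red_mult) (metis rangeI red_mult)

text \<open>As \<open>1 - x\<close> vanishes at 1, the ideal generated by \<open>\<pi>\<close>
  consists of the classes whose zeroth moment is 0 modulo 7.\<close>

lemma residue_A_red: "residue_A w (red p) = moment 0 p mod 7"
proof -
  have pi: "pi_A w = red [:1, -1:]" by (simp add: pi_A_def red_def)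
  have "red p \<ominus>\<^bsub>A7 w\<^esub> to_A w (of_int a) \<in> PIdl\<^bsub>A7 w\<^esub> (pi_A w) \<longleftrightarrow> [moment 0 p = a] (mod 7)" for a
  proof -
    have "red p \<ominus>\<^bsub>A7 w\<^esub> to_A w (of_int a) \<in> PIdl\<^bsub>A7 w\<^esub> (pi_A w) \<longleftrightarrow>
        (\<exists>q. red (p - [:a:]) = red (q * [:1, -1:]))"
      unfolding pi to_A_int red_diff PIdl_A7 by blast
    also have "\<dots> \<longleftrightarrow> 7 dvd moment 0 (p - [:a:])"
    proof
      assume "\<exists>q. red (p - [:a:]) = red (q * [:1, -1:])"
      then obtain q where "red (p - [:a:]) = red (q * [:1, -1:])" by blast
      then have "[moment 0 (p - [:a:]) = moment 0 (q * [:1, -1:])] (mod 7)"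
        unfolding red_eq_iff by blast
      then show "7 dvd moment 0 (p - [:a:])"
        by (simp add: moment_0_eq_poly cong_0_iff)
    next
      assume "7 dvd moment 0 (p - [:a:])"
      then obtain q n where q: "p - [:a:] = [:-1, 1:] * q + [:7 * n:]" by (rule linear_factor)
      have "red (p - [:a:]) = red (- q * [:1, -1:])"
        unfolding red_eq_iff cong_iff_dvd_diff
      proof (intro allI impI)
        fix k
        have "p - [:a:] - (- q * [:1, -1:]) = Polynomial.smult 7 [:n:]" by (simp add: q)
        then show "7 dvd moment k (p - [:a:]) - moment k (- q * [:1, -1:])"
          by (metis moment_diff moment_smult dvd_triv_left)
      qed
      then show "\<exists>q. red (p - [:a:]) = red (q * [:1, -1:])" by blast
    qed
    finally show ?thesis by (simp add: cong_iff_dvd_diff)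
  qed
  then show ?thesis unfolding residue_A_def
    by (intro the_equality) (auto simp: cong_def)
qed

text \<open>Division by the residue \<open>a\<close> is multiplication by \<open>a ^ 5\<close>.
  Comparing \<open>k\<close>-th moments then reads off \<open>k!\<close> times the coefficient
  \<open>c k\<close>; the prescribed range and the value 0 outside \<open>{1..5}\<close> make the
  coefficient function unique.\<close>

lemma log_coeffs_red:
  assumes "\<not> 7 dvd moment 0 p" "j \<in> {1..5}"
  defines "a \<equiv> moment 0 p mod 7"
  shows "log_coeffs w (red p) j = (moment j (log_poly (p * [:a ^ 5:])) * fact j ^ 5) mod 7"
proof -
  define q where "q = p * [:a ^ 5:]"
  define c0 where "c0 k = (if k \<in> {1..5} then (moment k (log_poly q) * fact k ^ 5) mod 7 else 0)" for k
  have a: "\<not> 7 dvd a" using assms(1) by (simp add: a_def dvd_mod_iff)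
  have "log_A w (red p \<otimes>\<^bsub>A7 w\<^esub> inv\<^bsub>A7 w\<^esub> (to_A w (of_int (residue_A w (red p))))) = red (log_poly q)"
    unfolding residue_A_red a_def[symmetric] inv_red_int[OF a] red_mult q_def log_A_red ..
  moreover have "(\<Oplus>\<^bsub>A7 w\<^esub>j\<in>{1..5::nat}. to_A w (of_int (c j)) \<otimes>\<^bsub>A7 w\<^esub> (Lambda w [^]\<^bsub>A7 w\<^esub> j)) =
      red (Lambda_comb c)" for c
    unfolding Lambda_red to_A_int red_pow red_mult Lambda_comb_def by (rule red_finsum) simp
  moreover have "red (log_poly q) = red (Lambda_comb c) \<longleftrightarrow>
      (\<forall>k\<in>{1..5}. [c k = moment k (log_poly q) * fact k ^ 5] (mod 7))" for c
  proof -
    have "[moment 0 p * a ^ 5 = a * a ^ 5] (mod 7)"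
      by (intro cong_mult cong_refl) (simp add: a_def cong_def)
    then have "[moment 0 q = 1] (mod 7)"
      using int_fermat_7[OF a] by (simp only: q_def moment_mult moment_const) (rule cong_trans)
    then have 0: "[moment 0 (log_poly q) = 0] (mod 7)" by (rule moment_0_log_poly)
    have "[moment k (log_poly q) = moment k (Lambda_comb c)] (mod 7) \<longleftrightarrow>
        (k \<noteq> 0 \<longrightarrow> [c k = moment k (log_poly q) * fact k ^ 5] (mod 7))" if "k \<le> 5" for k
    proof -
      have "[moment k (log_poly q) = moment k (Lambda_comb c)] (mod 7) \<longleftrightarrow>
          [moment k (log_poly q) = (if k = 0 then 0 else c k * fact k)] (mod 7)"
        using moment_Lambda_comb[OF that, of c] by (meson cong_sym cong_trans)
      then show ?thesis using 0 int_fermat_7_solve[OF not_7_dvd_fact[OF that]] by auto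
    qed
    then have "red (log_poly q) = red (Lambda_comb c) \<longleftrightarrow>
        (\<forall>k\<le>5. k \<noteq> 0 \<longrightarrow> [c k = moment k (log_poly q) * fact k ^ 5] (mod 7))"
      unfolding red_eq_iff by blast
    also have "\<dots> \<longleftrightarrow> (\<forall>k\<in>{1..5}. [c k = moment k (log_poly q) * fact k ^ 5] (mod 7))"
      by (auto simp: Suc_le_eq)
    finally show ?thesis .
  qed
  ultimately have "log_coeffs w (red p) = (THE c. (\<forall>j\<in>{1..5}. c j \<in> {0..<7}) \<and> (\<forall>j. j \<notin> {1..5} \<longrightarrow> c j = 0) \<and>
      (\<forall>k\<in>{1..5}. [c k = moment k (log_poly q) * fact k ^ 5] (mod 7)))"
    unfolding log_coeffs_def by presburger
  also have "\<dots> = c0"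
  proof (rule the_equality)
    fix c assume c: "(\<forall>j\<in>{1..5}. c j \<in> {0..<7}) \<and> (\<forall>j. j \<notin> {1..5} \<longrightarrow> c j = 0) \<and>
      (\<forall>k\<in>{1..5}. [c k = moment k (log_poly q) * fact k ^ 5] (mod 7))"
    show "c = c0"
    proof
      fix k
      show "c k = c0 k"
      proof (cases "k \<in> {1..5}")
        case True
        then have "c k \<in> {0..<7}" "[c k = moment k (log_poly q) * fact k ^ 5] (mod 7)" using c by blast+
        then show ?thesis using True by (simp add: c0_def cong_def)
      next
        case False
        then have "c k = 0" using c by blast
        then show ?thesis unfolding c0_def if_not_P[OF False] .
      qed
    qed
  qed (simp add: c0_def cong_def)
  finally show ?thesis using assms(2) by (simp add: c0_def q_def)
qed

text \<open>The factors 4 and \<open>3!\<close> and the power of the residue are units modulo 7, so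
  only the third cumulant decides.\<close>

lemma d_A_eq_0_iff:
  assumes "\<not> 7 dvd moment 0 p"
  shows "d_A w (to_A w (ev p w)) = 0 \<longleftrightarrow> 7 dvd cumul3 p"
proof -
  define a where "a = moment 0 p mod 7"
  define q where "q = p * [:a ^ 5:]"
  have a: "\<not> 7 dvd a" using assms by (simp add: a_def dvd_mod_iff)
  have "[moment 0 p * a ^ 5 = a * a ^ 5] (mod 7)"
    by (intro cong_mult cong_refl) (simp add: a_def cong_def)
  then have "[moment 0 q = 1] (mod 7)"
    using int_fermat_7[OF a] by (simp only: q_def moment_mult moment_const) (rule cong_trans)
  then have "[moment 3 (log_poly q) = cumul3 q] (mod 7)" by (rule moment_3_log_poly)
  moreover have "cumul3 q = (a ^ 5) ^ 3 * cumul3 p"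
    unfolding q_def cumul3_mult by (simp add: cumul3_def)
  ultimately have "7 dvd moment 3 (log_poly q) \<longleftrightarrow> 7 dvd cumul3 p"
    using a by (simp add: cong_dvd_iff prime_dvd_mult_iff prime_dvd_power_iff)
  moreover have "d_A w (red p) = (4 * (moment 3 (log_poly q) * fact 3 ^ 5)) mod 7"
    unfolding d_A_def using log_coeffs_red[OF assms, of 3] by (simp add: a_def q_def mod_mult_right_eq)
  moreover have "(4 * (moment 3 (log_poly q) * fact 3 ^ 5)) mod 7 = 0 \<longleftrightarrow> 7 dvd moment 3 (log_poly q)"
    unfolding dvd_eq_mod_eq_0[symmetric] by (simp add: prime_dvd_mult_iff fact_numeral)
  ultimately show ?thesis by (simp add: red_def)
qed

end

section \<open>Primes with nonzero d\<close>

context root7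
begin

text \<open>Primality expressed on representatives. The value 0 also qualifies, as it generates a
  prime ideal.\<close>

definition rprime :: "int poly \<Rightarrow> bool" where
  "rprime z \<longleftrightarrow> nrm z \<noteq> 1 \<and> (\<forall>x y. ev (x * y) w \<in> PIdl\<^bsub>R\<^esub> (ev z w) \<longrightarrow>
     ev x w \<in> PIdl\<^bsub>R\<^esub> (ev z w) \<or> ev y w \<in> PIdl\<^bsub>R\<^esub> (ev z w))"

text \<open>By \<open>d_A_eq_0_iff\<close> this says that the value at \<open>w\<close> is prime to
  7 and has nonzero \<open>d\<close>.\<close>

definition visible :: "int poly \<Rightarrow> bool" where
  "visible p \<longleftrightarrow> \<not> 7 dvd moment 0 p \<and> \<not> 7 dvd cumul3 p"

lemma visible_cong:
  assumes "ev p w = ev q w"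
  shows "visible p \<longleftrightarrow> visible q"
  using moment_cong[OF assms, of 0] cumul3_cong[OF assms] by (simp add: visible_def cong_dvd_iff)

lemma visible_mult:
  assumes "visible (p * q)"
  shows "visible p \<or> visible q"
  using assms by (auto simp: visible_def cumul3_mult moment_mult)

lemma visible_not_unit: "visible p \<Longrightarrow> nrm p \<noteq> 1"
  using unit_cumul3 by (auto simp: visible_def)

lemma visible_mult_unit:
  assumes "visible p" "nrm u = 1"
  shows "visible (p * u)"
proof -
  have "\<not> 7 dvd moment 0 u"
  proof
    assume "7 dvd moment 0 u"
    then have "[moment 0 u ^ 6 = 0 ^ 6] (mod 7)" by (intro cong_pow) (simp add: cong_0_iff)
    then have "[nrm u = 0 ^ 6] (mod 7)" using nrm_cong cong_trans by blast
    then show False using assms(2) by (simp add: cong_def)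
  qed
  moreover have "7 dvd cumul3 u" using assms(2) by (rule unit_cumul3)
  ultimately show ?thesis using assms(1)
    by (simp add: visible_def cumul3_mult moment_mult prime_dvd_mult_iff prime_dvd_power_iff dvd_add_left_iff)
qed

lemma visible_subst_pow:
  assumes "visible p" "\<not> 7 dvd a"
  shows "visible (subst_pow a p)"
  using assms by (simp add: visible_def cumul3_subst_pow moment_subst_pow prime_dvd_mult_iff prime_dvd_power_iff)
    presburger

lemma ideal_generator:
  assumes "ideal I R"
  obtains g where "I = PIdl\<^bsub>R\<^esub> (ev g w)"
proof -
  interpret I: ideal I R by fact
  define J where "J = {p. ev p w \<in> I}"
  have mult: "r * p \<in> J" if "p \<in> J" for r p
    using that I.I_l_closed[of "ev p w" "ev r w"] by (simp add: J_def)
  have add: "p + q \<in> J" if "p \<in> J" "q \<in> J" for p q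
    using that I.a_closed[of "ev p w" "ev q w"] by (simp add: J_def)
  have "0 \<in> J" using I.zero_closed by (simp add: J_def)
  moreover have "p - q \<in> J" if "p \<in> J" "q \<in> J" for p q
    using add[OF that(1) mult[OF that(2), of "-1"]] by simp
  ultimately obtain g where g: "g \<in> J" "\<And>p. p \<in> J \<Longrightarrow> \<exists>y. ev p w = ev (y * g) w"
    using principal[of J] mult by metis
  have "I = PIdl\<^bsub>R\<^esub> (ev g w)"
  proof
    show "I \<subseteq> PIdl\<^bsub>R\<^esub> (ev g w)"
    proof
      fix x assume "x \<in> I"
      then have "x \<in> carrier R" by (rule I.a_Hcarr)
      then obtain p where "x = ev p w" unfolding carrier_R by blast
      with \<open>x \<in> I\<close> g(2) show "x \<in> PIdl\<^bsub>R\<^esub> (ev g w)" unfolding PIdl_R by (auto simp: J_def)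
    qed
    show "PIdl\<^bsub>R\<^esub> (ev g w) \<subseteq> I"
      using mult[OF g(1)] unfolding PIdl_R by (auto simp: J_def)
  qed
  then show ?thesis by (rule that)
qed

text \<open>Take a visible divisor of least norm. Any factorization of it has a visible factor,
  which by minimality carries the whole norm, so the other factor is a unit. Bezout then turns
  irreducibility into primality.\<close>

lemma visible_divisor_exists:
  assumes "visible z0"
  obtains z where "visible z" "rprime z" "ev z0 w \<in> PIdl\<^bsub>R\<^esub> (ev z w)"
proof -
  define D where "D z \<longleftrightarrow> visible z \<and> ev z0 w \<in> PIdl\<^bsub>R\<^esub> (ev z w)" for z
  have "D z0" using assms by (auto simp: D_def ev_in_PIdl_iff intro: exI[of _ 1])
  from ex_has_least_nat[of D, OF this, of "\<lambda>z. nat (nrm z)"]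
  obtain z where z: "D z" and min: "\<And>y. D y \<Longrightarrow> nat (nrm z) \<le> nat (nrm y)" by blast
  have vis: "visible z" using z by (simp add: D_def)
  have z_pos: "nrm z > 0"
  proof -
    have "ev z w \<noteq> 0"
    proof
      assume "ev z w = 0"
      then have "visible 0" using vis visible_cong[of z 0] by simp
      then show False by (simp add: visible_def)
    qed
    then show ?thesis by (simp add: nrm_pos_iff)
  qed
  have irr: "nrm b = 1" if "ev z w = ev (a * b) w" "visible a" for a b
  proof -
    have nz: "nrm z = nrm a * nrm b" using nrm_cong_ev[OF that(1)] by (simp add: nrm_mult)
    have "D a"
    proof -
      obtain q where "ev z0 w = ev (q * z) w" using z unfolding D_def ev_in_PIdl_iff by blast
      then have "ev z0 w = ev (q * b * a) w" using that(1) by simp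
      then show ?thesis using that(2) unfolding D_def ev_in_PIdl_iff by blast
    qed
    then have le: "nrm z \<le> nrm a" using min[of a] nrm_nonneg[of a] by simp
    have "nrm a > 0" "nrm b > 0"
      using z_pos nz nrm_nonneg[of a] nrm_nonneg[of b] by (auto simp: zero_less_mult_iff)
    then have "nrm b \<le> 1" using nz le mult_le_cancel_left_pos[of "nrm a" "nrm b" 1] by simp
    then show ?thesis using \<open>nrm b > 0\<close> by simp
  qed
  have "rprime z"
    unfolding rprime_def
  proof (intro conjI allI impI)
    show "nrm z \<noteq> 1" using vis by (rule visible_not_unit)
    fix x y assume xy: "ev (x * y) w \<in> PIdl\<^bsub>R\<^esub> (ev z w)"
    \<comment> \<open>The generator \<open>g\<close> of this ideal is a greatest common divisor of
      \<open>x\<close> and \<open>z\<close>. If \<open>g\<close> is a unit then \<open>z\<close>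
      divides \<open>y\<close>; if the cofactor \<open>c\<close> is a unit then \<open>z\<close>
      divides \<open>x\<close>.\<close>
    define J where "J = {a * x + b * z | a b. True}"
    have "0 \<in> J" unfolding J_def by (auto intro!: exI[of _ 0])
    moreover have "p - q \<in> J" if "p \<in> J" "q \<in> J" for p q
    proof -
      obtain a b a' b' where "p = a * x + b * z" "q = a' * x + b' * z" using \<open>p \<in> J\<close> \<open>q \<in> J\<close> by (auto simp: J_def)
      then have "p - q = (a - a') * x + (b - b') * z" by (simp add: algebra_simps)
      then show ?thesis unfolding J_def by blast
    qed
    moreover have "r * p \<in> J" if "p \<in> J" for r p
    proof -
      obtain a b where "p = a * x + b * z" using \<open>p \<in> J\<close> by (auto simp: J_def)
      then have "r * p = (r * a) * x + (r * b) * z" by (simp add: algebra_simps)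
      then show ?thesis unfolding J_def by blast
    qed
    ultimately obtain g where g: "g \<in> J" "\<And>p. p \<in> J \<Longrightarrow> \<exists>y. ev p w = ev (y * g) w"
      using principal[of J] by metis
    have "0 * x + 1 * z \<in> J" "1 * x + 0 * z \<in> J" unfolding J_def by blast+
    then have "z \<in> J" "x \<in> J" by simp_all
    then obtain c e where c: "ev z w = ev (c * g) w" and e: "ev x w = ev (e * g) w"
      using g(2) by meson
    have "visible (c * g)" using vis visible_cong[OF c] by simp
    then consider "visible c" | "visible g" using visible_mult by blast
    then show "ev x w \<in> PIdl\<^bsub>R\<^esub> (ev z w) \<or> ev y w \<in> PIdl\<^bsub>R\<^esub> (ev z w)"
    proof cases
      case 1
      then have "nrm g = 1" using irr[OF c] by simp
      then obtain h where h: "ev (g * h) w = 1" using nrm_1_iff by blast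
      obtain a b where ab: "g = a * x + b * z" using g(1) by (auto simp: J_def)
      obtain q where q: "ev (x * y) w = ev (q * z) w" using xy unfolding ev_in_PIdl_iff by blast
      have "ev y w = ev (g * h) w * ev y w" using h by simp
      also have "\<dots> = ev (h * a) w * ev (x * y) w + ev (h * b * y * z) w"
        by (simp add: ab algebra_simps)
      also have "\<dots> = ev ((h * a * q + h * b * y) * z) w"
        unfolding q by (simp add: algebra_simps)
      finally show ?thesis unfolding ev_in_PIdl_iff by blast
    next
      case 2
      then have "nrm c = 1" using irr[of g c] c by (simp add: mult.commute)
      then obtain h where h: "ev (c * h) w = 1" using nrm_1_iff by blast
      have "ev x w = ev (c * h) w * ev (e * g) w" using h e by simp
      also have "\<dots> = ev (e * h) w * ev (c * g) w" by simp
      also have "\<dots> = ev (e * h * z) w" using c by simp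
      finally show ?thesis unfolding ev_in_PIdl_iff by blast
    qed
  qed
  then show ?thesis using that z by (auto simp: D_def)
qed

lemma rprime_primeideal:
  assumes "rprime z"
  shows "primeideal (PIdl\<^bsub>R\<^esub> (ev z w)) R"
proof (rule primeidealI)
  show "ideal (PIdl\<^bsub>R\<^esub> (ev z w)) R" by (rule R.cgenideal_ideal) simp
  show "carrier R \<noteq> PIdl\<^bsub>R\<^esub> (ev z w)"
  proof
    assume "carrier R = PIdl\<^bsub>R\<^esub> (ev z w)"
    then have "ev 1 w \<in> PIdl\<^bsub>R\<^esub> (ev z w)" using ev_in_R by blast
    then have "\<exists>q. ev (z * q) w = 1" unfolding ev_in_PIdl_iff by (auto simp: mult.commute)
    then show False using assms nrm_1_iff by (simp add: rprime_def)
  qed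
  fix a b assume "a \<in> carrier R" "b \<in> carrier R" "a \<otimes>\<^bsub>R\<^esub> b \<in> PIdl\<^bsub>R\<^esub> (ev z w)"
  moreover from this obtain x y where "a = ev x w" "b = ev y w" unfolding carrier_R by blast
  ultimately show "a \<in> PIdl\<^bsub>R\<^esub> (ev z w) \<or> b \<in> PIdl\<^bsub>R\<^esub> (ev z w)"
    using assms by (simp add: rprime_def)
qed (rule R.is_cring)

lemma nrm_in_PIdl: "of_int (nrm g) \<in> PIdl\<^bsub>R\<^esub> (ev g w)"
  unfolding PIdl_R using ev_conj_prod[of g]
  by (auto intro!: exI[of _ "conj_prod g"] simp: mult.commute)

lemma one_notin_primeideal:
  assumes "primeideal P R"
  shows "1 \<notin> P"
proof
  interpret P: primeideal P R by fact
  assume "1 \<in> P"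
  then have "\<one>\<^bsub>R\<^esub> \<in> P" by simp
  then show False using P.one_imp_carrier P.I_notcarr by blast
qed

text \<open>Otherwise Bezout for \<open>l\<close> and \<open>n\<close> would put 1 into the prime
  ideal.\<close>

lemma prime_ideal_int_dvd:
  assumes "primeideal I R" "of_nat l \<in> I" "of_int n \<in> I" "Factorial_Ring.prime l"
  shows "int l dvd n"
proof (rule ccontr)
  interpret I: primeideal I R by fact
  assume "\<not> int l dvd n"
  then have "coprime (int l) n" using assms(4) by (simp add: prime_imp_coprime)
  then obtain a b where ab: "a * int l + b * n = 1" by (metis bezout_int coprime_iff_gcd_eq_1)
  have carr: "of_int k \<in> carrier R" for k using ev_in_R[of "[:k:]"] by simp
  have "of_int a * of_nat l \<in> I" "of_int b * of_int n \<in> I"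
    using I.I_l_closed[OF assms(2) carr[of a]] I.I_l_closed[OF assms(3) carr[of b]] by simp_all
  then have "of_int a * of_nat l + of_int b * of_int n \<in> I" using I.a_closed by fastforce
  also have "of_int a * of_nat l + of_int b * of_int n = complex_of_int (a * int l + b * n)" by simp
  finally show False using one_notin_primeideal[OF assms(1)] by (simp add: ab)
qed

lemma rprime_dvd_prod:
  assumes "rprime z" "finite S" "ev (\<Prod>a\<in>S. f a) w \<in> PIdl\<^bsub>R\<^esub> (ev z w)"
  obtains a where "a \<in> S" "ev (f a) w \<in> PIdl\<^bsub>R\<^esub> (ev z w)"
proof -
  have "\<exists>a\<in>S. ev (f a) w \<in> PIdl\<^bsub>R\<^esub> (ev z w)" using assms(2,3)
  proof (induction S)
    case empty
    then have "\<exists>q. ev (z * q) w = 1" unfolding ev_in_PIdl_iff by (auto simp: mult.commute)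
    then show ?case using assms(1) nrm_1_iff by (simp add: rprime_def)
  next
    case (insert a S)
    then have "ev (f a * (\<Prod>a\<in>S. f a)) w \<in> PIdl\<^bsub>R\<^esub> (ev z w)" by simp
    then show ?case using assms(1) insert.IH unfolding rprime_def by blast
  qed
  then show ?thesis using that by blast
qed

text \<open>The prime ideals above a rational prime are conjugate, so visibility of one generator passes to
  the generator of any other.\<close>

lemma visible_generator:
  assumes z: "visible z" "rprime z" and l: "Factorial_Ring.prime l" "of_nat l \<in> PIdl\<^bsub>R\<^esub> (ev z w)"
    and I: "primeideal (PIdl\<^bsub>R\<^esub> (ev g w)) R" "of_nat l \<in> PIdl\<^bsub>R\<^esub> (ev g w)"
  shows "visible g"
proof -
  interpret P: primeideal "PIdl\<^bsub>R\<^esub> (ev g w)" R by (rule I(1))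
  have "int l dvd nrm g" using prime_ideal_int_dvd[OF I nrm_in_PIdl l(1)] .
  then obtain k where k: "nrm g = int l * k" by blast
  obtain q where q: "of_nat l = ev (q * z) w" using l(2) unfolding PIdl_R by blast
  \<comment> \<open>The product of the conjugates of \<open>g\<close> is a multiple of
    \<open>l\<close>, hence lies in the prime ideal of \<open>z\<close>, which must contain one of
    them.\<close>
  have "ev (\<Prod>a=1..6. subst_pow a g) w = of_int (nrm g)"
    by (simp add: of_int_nrm norm_prod_def)
  also have "\<dots> = of_nat l * of_int k" by (simp add: k)
  also have "\<dots> = ev ([:k:] * q * z) w" by (simp add: q)
  finally have "ev (\<Prod>a=1..6. subst_pow a g) w \<in> PIdl\<^bsub>R\<^esub> (ev z w)" unfolding ev_in_PIdl_iff by blast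
  then obtain a where a: "a \<in> {1..6}" "ev (subst_pow a g) w \<in> PIdl\<^bsub>R\<^esub> (ev z w)"
    by (rule rprime_dvd_prod[OF z(2), rotated]) auto
  then obtain r where r: "ev (subst_pow a g) w = ev (r * z) w" unfolding ev_in_PIdl_iff by blast
  obtain b where b: "a * b mod 7 = 1" "\<not> 7 dvd b" using inverse_mod_7[OF a(1)] .
  have wab: "(w ^ b) ^ a = w"
    by (metis b(1) mult.commute pow_mod7 power_mult power_one_right)
  \<comment> \<open>The inverse automorphism turns this into a factorization of \<open>g\<close>
    through a conjugate of \<open>z\<close>.\<close>
  have g: "ev g w = ev (subst_pow b r * subst_pow b z) w"
    using ev_eq_conj[OF r b(2)] wab by simp
  have mem: "ev (subst_pow b r) w \<otimes>\<^bsub>R\<^esub> ev (subst_pow b z) w \<in> PIdl\<^bsub>R\<^esub> (ev g w)"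
    using R.cgenideal_self[OF ev_in_R[of g]] by (simp only: R_simps ev_mult[symmetric] g[symmetric])
  have gnz: "ev g w \<noteq> 0"
  proof
    assume "ev g w = 0"
    then have "of_nat l = (0 :: complex)" using I(2) unfolding PIdl_R by auto
    then show False using l(1) by simp
  qed
  have vz: "visible (subst_pow b z)" using z(1) b(2) by (rule visible_subst_pow)
  from mem consider "ev (subst_pow b r) w \<in> PIdl\<^bsub>R\<^esub> (ev g w)" | "ev (subst_pow b z) w \<in> PIdl\<^bsub>R\<^esub> (ev g w)"
    using P.I_prime ev_in_R by blast
  \<comment> \<open>Primality puts one factor into the ideal of \<open>g\<close>. If it is the
    first, the conjugate of \<open>z\<close> would be a unit, which visibility excludes; if the
    second, \<open>g\<close> is that conjugate times a unit.\<close>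
  then show ?thesis
  proof cases
    case 1
    then obtain s where s: "ev (subst_pow b r) w = ev (s * g) w" unfolding ev_in_PIdl_iff by blast
    then have "ev g w = ev g w * ev (subst_pow b z * s) w" using g unfolding ev_mult s by (simp only: mult_ac)
    then have "ev (subst_pow b z * s) w = 1" using gnz by (metis mult_cancel_left1)
    then have "nrm (subst_pow b z) = 1" using nrm_1_iff by blast
    then show ?thesis using visible_not_unit vz by blast
  next
    case 2
    then obtain s where s: "ev (subst_pow b z) w = ev (s * g) w" unfolding ev_in_PIdl_iff by blast
    then have "ev g w = ev g w * ev (subst_pow b r * s) w" using g unfolding ev_mult s by (simp only: mult_ac)
    then have "ev (subst_pow b r * s) w = 1" using gnz by (metis mult_cancel_left1)
    then have "nrm (subst_pow b r) = 1" using nrm_1_iff by blast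
    then have "visible (subst_pow b z * subst_pow b r)" using visible_mult_unit vz by blast
    then show ?thesis using visible_cong[OF g] by (simp add: mult.commute)
  qed
qed

lemma prime_ideal_contains_prime:
  assumes "primeideal P R" "of_nat n \<in> P" "n > 0"
  obtains l where "Factorial_Ring.prime l" "of_nat l \<in> P"
proof -
  interpret P: primeideal P R by fact
  have carr: "of_nat k \<in> carrier R" for k using ev_in_R[of "[:int k:]"] by simp
  have one: "1 \<notin> P" using one_notin_primeideal[OF assms(1)] .
  have "\<exists>l. Factorial_Ring.prime l \<and> of_nat l \<in> P" using assms(2,3)
  proof (induction n rule: less_induct)
    case (less n)
    have "n \<noteq> 1" using less.prems(1) one by auto
    then obtain q where q: "Factorial_Ring.prime q" "q dvd n" using prime_factor_nat by blast
    then obtain m where m: "n = q * m" by blast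
    have "of_nat q \<otimes>\<^bsub>R\<^esub> of_nat m \<in> P" using less.prems(1) m by simp
    then consider "of_nat q \<in> P" | "of_nat m \<in> P" using P.I_prime carr by blast
    then show ?case
    proof cases
      case 1
      then show ?thesis using q(1) by blast
    next
      case 2
      have "m > 0" using less.prems(2) m by (cases m) auto
      moreover have "m < n" using m prime_gt_1_nat[OF q(1)] \<open>m > 0\<close> by simp
      ultimately show ?thesis using less.IH 2 by blast
    qed
  qed
  then show ?thesis using that by blast
qed

text \<open>All positive moments of \<open>1 + c * x\<close> equal \<open>c\<close>, so its third
  cumulant is \<open>c - c ^ 2\<close> after clearing denominators; for \<open>c = 2\<close> this
  and the residue 3 are nonzero modulo 7.\<close>

lemma visible_linear:
  assumes "[c = 2] (mod 7)"
  shows "visible [:1, c:]"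
proof -
  have "[:1, c:] = [:1:] + Polynomial.monom c 1" by (simp add: monom_Suc monom_0)
  then have m0: "moment 0 [:1, c:] = 1 + c" and mk: "k > 0 \<Longrightarrow> moment k [:1, c:] = c" for k
    by (simp_all only: moment_add moment_monom moment_const) simp_all
  have "cumul3 [:1, c:] = c - c\<^sup>2"
    using mk[of 1] mk[of 2] mk[of 3] by (simp add: cumul3_def m0 power2_eq_square power3_eq_cube algebra_simps)
  also have "[c - c\<^sup>2 = 2 - 2\<^sup>2] (mod 7)" using assms by (intro cong_diff cong_pow)
  also have "[2 - 2\<^sup>2 = 5] (mod (7 :: int))" by (simp add: cong_def)
  finally have "7 dvd cumul3 [:1, c:] \<longleftrightarrow> 7 dvd (5 :: int)" by (rule cong_dvd_iff)
  then have "\<not> 7 dvd cumul3 [:1, c:]" by presburger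
  moreover have "[1 + c = 1 + 2] (mod 7)" using assms by (intro cong_add cong_refl)
  then have "7 dvd moment 0 [:1, c:] \<longleftrightarrow> 7 dvd (1 + 2 :: int)" unfolding m0 by (rule cong_dvd_iff)
  then have "\<not> 7 dvd moment 0 [:1, c:]" by presburger
  ultimately show ?thesis by (simp add: visible_def)
qed

text \<open>Both the prime ideal above \<open>l\<close> and its generator are arbitrary choices;
  \<open>visible_generator\<close> covers every such choice.\<close>

lemma visible_d_ideal:
  assumes z: "visible z" "rprime z" and l: "Factorial_Ring.prime l" "of_nat l \<in> PIdl\<^bsub>R\<^esub> (ev z w)"
  shows "d_ideal w (prime_above w l) \<noteq> 0"
proof -
  define q where "q = prime_above w l"
  have "\<exists>q. primeideal q R \<and> of_nat l \<in> q" using rprime_primeideal[OF z(2)] l(2) by blast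
  then have "primeideal q R \<and> of_nat l \<in> q"
    unfolding q_def prime_above_def by (rule someI_ex)
  then have q: "primeideal q R" "of_nat l \<in> q" by simp_all
  then interpret q: primeideal q R by simp
  obtain g where "q = PIdl\<^bsub>R\<^esub> (ev g w)" using ideal_generator[OF q.is_ideal] .
  then have "\<exists>g. g \<in> carrier R \<and> q = PIdl\<^bsub>R\<^esub> g" by blast
  then have gen: "generator w q \<in> carrier R \<and> q = PIdl\<^bsub>R\<^esub> (generator w q)"
    unfolding generator_def by (rule someI_ex)
  then obtain h where h: "generator w q = ev h w" unfolding carrier_R by blast
  have "visible h" using visible_generator[OF z l, of h] q gen unfolding h by simp
  then show ?thesis unfolding d_ideal_def q_def[symmetric] h
    using d_A_eq_0_iff by (simp add: visible_def)
qed

lemma delta_range: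
  assumes "d_ideal w (prime_above w l) \<noteq> 0"
  shows "delta w l \<in> {1..3}"
proof -
  have range: "(THE k. k \<in> {0..3} \<and> ([k = d] (mod 7) \<or> [k = - d] (mod 7))) \<in> {1..3}"
    if "d \<in> {1,2,3,4,5,6}" for d :: int
  proof -
    define k where "k = (if d \<le> 3 then d else 7 - d)"
    have "(THE k. k \<in> {0..3} \<and> ([k = d] (mod 7) \<or> [k = - d] (mod 7))) = k"
    proof (rule the_equality)
      show "k \<in> {0..3} \<and> ([k = d] (mod 7) \<or> [k = - d] (mod 7))"
        using that unfolding k_def by (elim insertE) (simp_all add: cong_def)
      fix k' assume k': "k' \<in> {0..3} \<and> ([k' = d] (mod 7) \<or> [k' = - d] (mod 7))"
      then have "k' \<in> {0,1,2,3}" by auto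
      then show "k' = k" using that k' unfolding k_def
        by (elim insertE) (simp_all add: cong_def)
    qed
    moreover have "k \<in> {1..3}" using that unfolding k_def by (elim insertE) simp_all
    ultimately show ?thesis by simp
  qed
  have "d_ideal w (prime_above w l) \<in> {0..<7}" by (simp add: d_ideal_def d_A_def)
  then have "d_ideal w (prime_above w l) \<in> {1,2,3,4,5,6}" using assms by auto
  then show ?thesis unfolding delta_def by (rule range)
qed

lemma visible_prime:
  assumes N: "N > (0::int)"
  obtains l where "Factorial_Ring.prime l" "coprime (int l) N" "l \<noteq> 7"
    "delta w l \<in> {1..3}" "\<not> invisible w l"
proof -
  obtain M where M: "N = 7 ^ multiplicity 7 N * M" "\<not> 7 dvd M"
    using multiplicity_decompose'[of N 7] N by auto
  \<comment> \<open>By Fermat \<open>M ^ 6\<close> is 1 modulo 7, so \<open>c\<close> is a multiple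
    of \<open>M\<close> congruent to 2.\<close>
  define c where "c = 2 * (M * M ^ 5)"
  have "[c = 2 * 1] (mod 7)" unfolding c_def by (intro cong_mult cong_refl int_fermat_7 M(2))
  then have "visible [:1, c:]" using visible_linear by simp
  then obtain z where z: "visible z" "rprime z" "ev [:1, c:] w \<in> PIdl\<^bsub>R\<^esub> (ev z w)"
    by (rule visible_divisor_exists)
  interpret P: primeideal "PIdl\<^bsub>R\<^esub> (ev z w)" R using z(2) by (rule rprime_primeideal)
  have one: "1 \<notin> PIdl\<^bsub>R\<^esub> (ev z w)" using one_notin_primeideal[OF P.primeideal] .
  have nz: "\<not> 7 dvd nrm z"
  proof
    assume "7 dvd nrm z"
    then have "7 dvd moment 0 z ^ 6" using nrm_cong[of z] by (simp add: cong_dvd_iff)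
    then show False using z(1) by (simp add: visible_def prime_dvd_power_iff)
  qed
  then have "nrm z > 0" using nrm_nonneg[of z] by (cases "nrm z = 0") auto
  then have "of_nat (nat (nrm z)) \<in> PIdl\<^bsub>R\<^esub> (ev z w)" "nat (nrm z) > 0" using nrm_in_PIdl[of z] by simp_all
  then obtain l where l: "Factorial_Ring.prime l" "of_nat l \<in> PIdl\<^bsub>R\<^esub> (ev z w)"
    by (rule prime_ideal_contains_prime[OF P.primeideal])
  have "int l dvd nrm z" using prime_ideal_int_dvd[OF P.primeideal l(2) nrm_in_PIdl l(1)] .
  then have l7: "l \<noteq> 7" using nz by auto
  \<comment> \<open>Otherwise \<open>l\<close> divides \<open>M\<close> and so \<open>c\<close>;
    then the ideal of \<open>z\<close> contains both \<open>c * w\<close> and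
    \<open>1 + c * w\<close>, hence 1.\<close>
  have "\<not> int l dvd N"
  proof
    assume "int l dvd N"
    then have "int l dvd 7 ^ multiplicity 7 N \<or> int l dvd M"
      using M(1) l(1) by (metis prime_dvd_mult_iff prime_nat_int_transfer)
    moreover have "\<not> int l dvd 7 ^ multiplicity 7 N"
    proof
      assume "int l dvd 7 ^ multiplicity 7 N"
      then have "int l dvd 7" using l(1) prime_dvd_power by (metis prime_nat_int_transfer)
      then have "int l = 7" using l(1) by (intro primes_dvd_imp_eq) auto
      then show False using l7 by simp
    qed
    ultimately have "int l dvd c" by (auto simp: c_def)
    then obtain k where "c = int l * k" by blast
    then have "ev [:0, c:] w = ev [:0, k:] w * of_nat l" by (simp add: mult_ac)
    also have "\<dots> \<in> PIdl\<^bsub>R\<^esub> (ev z w)" using P.I_l_closed[OF l(2) ev_in_R[of "[:0, k:]"]] by (simp only: R_simps)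
    finally obtain s where s: "ev [:0, c:] w = ev (s * z) w" unfolding ev_in_PIdl_iff by blast
    obtain t where t: "ev [:1, c:] w = ev (t * z) w" using z(3) unfolding ev_in_PIdl_iff by blast
    have "ev 1 w = ev [:1, c:] w - ev [:0, c:] w" by simp
    also have "\<dots> = ev ((t - s) * z) w" unfolding s t by (simp add: algebra_simps)
    finally have "ev 1 w \<in> PIdl\<^bsub>R\<^esub> (ev z w)" unfolding ev_in_PIdl_iff by blast
    then show False using one by simp
  qed
  then have "coprime (int l) N" using l(1) by (intro prime_imp_coprime) auto
  moreover have d: "d_ideal w (prime_above w l) \<noteq> 0" using visible_d_ideal[OF z(1,2) l] .
  ultimately show ?thesis using that[of l] l(1) l7 delta_range[OF d] by (simp add: invisible_def)
qed

end

section \<open>Prime powers in both sets, and the conclusion\<close>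

lemma one_notin_L10: "1 \<notin> L10 \<omega>"
  by (simp add: L10_def cong_def)

lemma one_notin_L11: "1 \<notin> L11 \<omega>"
  by (simp add: L11_def usable_def)

lemma not_union_of_congruence_classes:
  assumes "x \<in> S" "y \<notin> S" "[x = y] (mod N)"
  shows "\<not> union_of_congruence_classes N S"
  using assms unfolding union_of_congruence_classes_def
  by (auto, meson cong_sym cong_trans)

text \<open>The order of \<open>l\<close> modulo 7 is at most 6, so the exponent
  \<open>18 * k\<close> allows coefficients up to 3 in absolute value, enough to bring any nonzero
  \<open>delta\<close> to 1 or -1.\<close>

lemma prime_power_in_L:
  assumes l: "Factorial_Ring.prime l" "l \<noteq> 7" and k: "k > 0"
    and vis: "delta \<omega> l \<in> {1..3}" "\<not> invisible \<omega> l"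
  shows "int l ^ (18 * k) \<in> L10 \<omega> \<inter> L11 \<omega>"
proof -
  define m where "m = int l ^ (18 * k)"
  have nat_m: "nat \<bar>m\<bar> = l ^ (18 * k)" by (simp add: m_def nat_power_eq flip: of_nat_power)
  have pf: "prime_factors (nat \<bar>m\<bar>) = {l}" using l(1) k by (simp add: nat_m prime_factorization_prime_power)
  have mult: "multiplicity l (nat \<bar>m\<bar>) = 18 * k" using l(1) by (simp add: nat_m)
  have "coprime l 7" using l by (intro primes_coprime) auto
  then have "coprime m 7" using coprime_int_iff[of l 7] by (auto simp: m_def)
  have "m \<noteq> 0" using l(1) by (auto simp: m_def)
  have "ord 7 l dvd totient 7" using \<open>coprime l 7\<close> by (intro order_divides_totient) (simp add: coprime_commute)
  then have ord: "ord 7 l \<le> 6" by (intro dvd_imp_le) (simp_all add: totient_prime)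
  have "usable m l" using ord k by (simp add: usable_def pf mult)
  then have "m \<in> L11 \<omega>" using vis(2) \<open>coprime m 7\<close> \<open>m \<noteq> 0\<close> by (auto simp: L11_def)
  have "ord 7 l > 0" using \<open>coprime l 7\<close> by (simp add: coprime_commute)
  then have "3 \<le> 18 * k div ord 7 l" using ord k by (simp add: less_eq_div_iff_mult_less_eq)
  \<comment> \<open>The products are \<open>1 * 1 = 1\<close>, \<open>3 * 2 = 6\<close> and
    \<open>2 * 3 = 6\<close>, that is, 1 or -1 modulo 7.\<close>
  define j where "j = (if delta \<omega> l = 1 then 1 else if delta \<omega> l = 2 then 3 else 2 :: int)"
  have "delta \<omega> l \<in> {1,2,3}" using vis(1) by auto
  then have "[j * delta \<omega> l = 1] (mod 7) \<or> [j * delta \<omega> l = -1] (mod 7)"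
    by (auto simp: j_def cong_def)
  moreover have "\<bar>j\<bar> \<le> int (18 * k div ord 7 l)"
    using \<open>3 \<le> _\<close> by (auto simp: j_def)
  ultimately have "m \<in> L10 \<omega>" using \<open>coprime m 7\<close> \<open>m \<noteq> 0\<close>
    unfolding L10_def mem_Collect_eq pf by (auto simp: mult intro!: exI[of _ "\<lambda>_. j"])
  with \<open>m \<in> L11 \<omega>\<close> show ?thesis by (simp add: m_def)
qed

theorem corollary1p3:
  fixes \<omega> :: complex
  assumes "\<omega> ^ 7 = 1" and "\<forall>k\<in>{1..<7::nat}. \<omega> ^ k \<noteq> 1"
  shows "\<forall>N::int. N > 0 \<longrightarrow>
    \<not> union_of_congruence_classes N (L10 \<omega>) \<and> \<not> union_of_congruence_classes N (L11 \<omega>)"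
proof (intro allI impI)
  fix N :: int assume N: "N > 0"
  interpret root7 \<omega> using assms by unfold_locales
  obtain l where l: "Factorial_Ring.prime l" "coprime (int l) N" "l \<noteq> 7"
    "delta \<omega> l \<in> {1..3}" "\<not> invisible \<omega> l"
    using visible_prime[OF N] .
  define k where "k = totient (nat N)"
  have "k > 0" using N by (simp add: k_def)
  have "coprime l (nat N)" using l(2) N by (metis coprime_int_iff int_nat_eq order_less_imp_le)
  then have "[l ^ k = 1] (mod nat N)" unfolding k_def by (rule euler_theorem)
  then have "[int l ^ k = 1] (mod N)" using N by (simp flip: cong_int_iff)
  then have "[(int l ^ k) ^ 18 = 1 ^ 18] (mod N)" by (rule cong_pow)
  then have "[int l ^ (18 * k) = 1] (mod N)" by (simp add: mult.commute flip: power_mult)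
  moreover have "int l ^ (18 * k) \<in> L10 \<omega> \<inter> L11 \<omega>"
    using prime_power_in_L[OF l(1,3) \<open>k > 0\<close> l(4,5)] .
  ultimately show "\<not> union_of_congruence_classes N (L10 \<omega>) \<and> \<not> union_of_congruence_classes N (L11 \<omega>)"
    using not_union_of_congruence_classes one_notin_L10 one_notin_L11 by blast
qed

end
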